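(* Let $\mathcal A$ be a category with a zero object. Then the homotopy category of an orthogonal model structure $(\mathrm{CoFib},\mathrm{Fib},\mathrm{Weq})$ on $\mathcal A$ is equivalent to the full subcategory of $\mathcal A$ consisting of the cofibrant-fibrant objects, i.e. of the objects $X$ such that $0\longrightarrow X$ lies in $\mathrm{CoFib}$ and $X\longrightarrow 0$ lies in $\mathrm{Fib}$.
   Context: A model structure on a category $\mathcal A$ is a triple $(\mathrm{CoFib},\mathrm{Fib},\mathrm{Weq})$ of classes of morphisms such that, with $\mathrm{TCoFib}:=\mathrm{CoFib}\cap\mathrm{Weq}$ and $\mathrm{TFib}:=\mathrm{Fib}\cap\mathrm{Weq}$: (CM1) $\mathrm{Weq}$ has the two-out-of-three property (if two of $f,g,g\circ f$ are in $\mathrm{Weq}$, so is the third); (CM2) the three classes are closed under retracts; (CM3) for every commutative square $p\circ a=b\circ i$ with $i:A\to B$, $p:X\to Y$, and either $i\in\mathrm{TCoFib}$, $p\in\mathrm{Fib}$ or $i\in\mathrm{CoFib}$, $p\in\mathrm{TFib}$, there is a lifting $s:B\to X$ with $s\circ i=a$, $p\circ s=b$; (CM4) every morphism factors as $p\circ i$ with $i\in\mathrm{TCoFib}$, $p\in\mathrm{Fib}$ and as $q\circ j$ with $j\in\mathrm{CoFib}$, $q\in\mathrm{TFib}$. No limits or colimits of $\mathcal A$ are assumed beyond the zero object. The model structure is orthogonal if the lifting in (CM3) is always unique. The homotopy category is $\mathrm{Ho}(\mathcal A):=\mathcal A[\mathrm{Weq}^{-1}]$, the localization of $\mathcal A$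 at $\mathrm{Weq}$. *)

theory Defs
  imports Main
begin

section \<open>Categories\<close>

text \<open>
  The values of \<open>Comp\<close> on non-composable pairs, and of \<open>Dom\<close>, \<open>Cod\<close>, \<open>Idn\<close> outside \<open>Ar\<close>
  and \<open>Ob\<close>, are unspecified and never used. \<open>Comp C g f\<close> is \<open>g\<close> after \<open>f\<close>.
\<close>

record ('o, 'm) cat =
  Ob :: "'o set"
  Ar :: "'m set"
  Dom :: "'m \<Rightarrow> 'o"
  Cod :: "'m \<Rightarrow> 'o"
  Idn :: "'o \<Rightarrow> 'm"
  Comp :: "'m \<Rightarrow> 'm \<Rightarrow> 'm" (infixr \<open>\<cdot>\<index>\<close> 70)

locale category =
  fixes C :: "('o, 'm) cat" (structure)
  assumes Dom_in [simp, intro]: "f \<in> Ar C \<Longrightarrow> Dom C f \<in> Ob C"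
    and Cod_in [simp, intro]: "f \<in> Ar C \<Longrightarrow> Cod C f \<in> Ob C"
    and Idn_in [simp, intro]: "x \<in> Ob C \<Longrightarrow> Idn C x \<in> Ar C"
    and Dom_Idn [simp]: "x \<in> Ob C \<Longrightarrow> Dom C (Idn C x) = x"
    and Cod_Idn [simp]: "x \<in> Ob C \<Longrightarrow> Cod C (Idn C x) = x"
    and Comp_in [simp, intro]:
      "\<lbrakk>f \<in> Ar C; g \<in> Ar C; Cod C f = Dom C g\<rbrakk> \<Longrightarrow> g \<cdot> f \<in> Ar C"
    and Dom_Comp [simp]:
      "\<lbrakk>f \<in> Ar C; g \<in> Ar C; Cod C f = Dom C g\<rbrakk> \<Longrightarrow> Dom C (g \<cdot> f) = Dom C f"
    and Cod_Comp [simp]: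
      "\<lbrakk>f \<in> Ar C; g \<in> Ar C; Cod C f = Dom C g\<rbrakk> \<Longrightarrow> Cod C (g \<cdot> f) = Cod C g"
    and Comp_Idn_right [simp]: "f \<in> Ar C \<Longrightarrow> f \<cdot> Idn C (Dom C f) = f"
    and Comp_Idn_left [simp]: "f \<in> Ar C \<Longrightarrow> Idn C (Cod C f) \<cdot> f = f"
    and Comp_assoc:
      "\<lbrakk>f \<in> Ar C; g \<in> Ar C; h \<in> Ar C; Cod C f = Dom C g; Cod C g = Dom C h\<rbrakk>
        \<Longrightarrow> (h \<cdot> g) \<cdot> f = h \<cdot> (g \<cdot> f)"

definition hom :: "('o, 'm) cat \<Rightarrow> 'o \<Rightarrow> 'o \<Rightarrow> 'm set" where
  "hom C x y = {f \<in> Ar C. Dom C f = x \<and> Cod C f = y}"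

definition inverse_arrows :: "('o, 'm) cat \<Rightarrow> 'm \<Rightarrow> 'm \<Rightarrow> bool" where
  "inverse_arrows C f g \<longleftrightarrow>
    f \<in> Ar C \<and> g \<in> hom C (Cod C f) (Dom C f) \<and>
    Comp C g f = Idn C (Dom C f) \<and> Comp C f g = Idn C (Cod C f)"

definition is_iso :: "('o, 'm) cat \<Rightarrow> 'm \<Rightarrow> bool" where
  "is_iso C f \<longleftrightarrow> (\<exists>g. inverse_arrows C f g)"

definition zero_object :: "('o, 'm) cat \<Rightarrow> 'o \<Rightarrow> bool" where
  "zero_object C z \<longleftrightarrow>
    z \<in> Ob C \<and> (\<forall>x \<in> Ob C. (\<exists>!f. f \<in> hom C z x) \<and> (\<exists>!f. f \<in> hom C x z))"

definition full_subcategory :: "('o, 'm) cat \<Rightarrow> 'o set \<Rightarrow> ('o, 'm) cat" where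
  "full_subcategory C S =
    C\<lparr>Ob := Ob C \<inter> S, Ar := {f \<in> Ar C. Dom C f \<in> S \<and> Cod C f \<in> S}\<rparr>"

section \<open>Functors, natural isomorphisms, equivalences\<close>

record ('o, 'm, 'p, 'n) ftor =
  FOb :: "'o \<Rightarrow> 'p"
  FAr :: "'m \<Rightarrow> 'n"

definition is_ftor ::
    "('o, 'm) cat \<Rightarrow> ('p, 'n) cat \<Rightarrow> ('o, 'm, 'p, 'n) ftor \<Rightarrow> bool" where
  "is_ftor C D F \<longleftrightarrow> category C \<and> category D \<and>
    (\<forall>x \<in> Ob C. FOb F x \<in> Ob D) \<and>
    (\<forall>f \<in> Ar C. FAr F f \<in> hom D (FOb F (Dom C f)) (FOb F (Cod C f))) \<and>
    (\<forall>x \<in> Ob C. FAr F (Idn C x) = Idn D (FOb F x)) \<and>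
    (\<forall>f \<in> Ar C. \<forall>g \<in> Ar C. Cod C f = Dom C g \<longrightarrow>
      FAr F (Comp C g f) = Comp D (FAr F g) (FAr F f))"

definition id_ftor :: "('o, 'm, 'o, 'm) ftor" where
  "id_ftor = \<lparr>FOb = (\<lambda>x. x), FAr = (\<lambda>f. f)\<rparr>"

definition comp_ftor ::
    "('p, 'n, 'q, 'l) ftor \<Rightarrow> ('o, 'm, 'p, 'n) ftor \<Rightarrow> ('o, 'm, 'q, 'l) ftor" where
  "comp_ftor G F = \<lparr>FOb = (\<lambda>x. FOb G (FOb F x)), FAr = (\<lambda>f. FAr G (FAr F f))\<rparr>"

definition naturally_isomorphic ::
    "('o, 'm) cat \<Rightarrow> ('p, 'n) cat \<Rightarrow> ('o, 'm, 'p, 'n) ftor \<Rightarrow> ('o, 'm, 'p, 'n) ftor \<Rightarrow> bool" where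
  "naturally_isomorphic C D F G \<longleftrightarrow> is_ftor C D F \<and> is_ftor C D G \<and>
    (\<exists>\<eta>. (\<forall>x \<in> Ob C. \<eta> x \<in> hom D (FOb F x) (FOb G x) \<and> is_iso D (\<eta> x)) \<and>
         (\<forall>f \<in> Ar C. Comp D (\<eta> (Cod C f)) (FAr F f) = Comp D (FAr G f) (\<eta> (Dom C f))))"

definition equivalent_categories :: "('o, 'm) cat \<Rightarrow> ('p, 'n) cat \<Rightarrow> bool" where
  "equivalent_categories C D \<longleftrightarrow>
    (\<exists>F G. is_ftor C D F \<and> is_ftor D C G \<and>
      naturally_isomorphic C C (comp_ftor G F) id_ftor \<and>
      naturally_isomorphic D D (comp_ftor F G) id_ftor)"

section \<open>Model structures\<close>

definition two_out_of_three :: "('o, 'm) cat \<Rightarrow> 'm set \<Rightarrow> bool" where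
  "two_out_of_three C W \<longleftrightarrow>
    (\<forall>f \<in> Ar C. \<forall>g \<in> Ar C. Cod C f = Dom C g \<longrightarrow>
      (f \<in> W \<and> g \<in> W \<longrightarrow> Comp C g f \<in> W) \<and>
      (f \<in> W \<and> Comp C g f \<in> W \<longrightarrow> g \<in> W) \<and>
      (g \<in> W \<and> Comp C g f \<in> W \<longrightarrow> f \<in> W))"

definition is_retract_of :: "('o, 'm) cat \<Rightarrow> 'm \<Rightarrow> 'm \<Rightarrow> bool" where
  "is_retract_of C f g \<longleftrightarrow> f \<in> Ar C \<and> g \<in> Ar C \<and>
    (\<exists>i r j s.
      i \<in> hom C (Dom C f) (Dom C g) \<and> r \<in> hom C (Dom C g) (Dom C f) \<and>
      j \<in> hom C (Cod C f) (Cod C g) \<and> s \<in> hom C (Cod C g) (Cod C f) \<and>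
      Comp C r i = Idn C (Dom C f) \<and> Comp C s j = Idn C (Cod C f) \<and>
      Comp C g i = Comp C j f \<and> Comp C f r = Comp C s g)"

definition closed_under_retracts :: "('o, 'm) cat \<Rightarrow> 'm set \<Rightarrow> bool" where
  "closed_under_retracts C K \<longleftrightarrow> (\<forall>f g. g \<in> K \<and> is_retract_of C f g \<longrightarrow> f \<in> K)"

definition commutative_square :: "('o, 'm) cat \<Rightarrow> 'm \<Rightarrow> 'm \<Rightarrow> 'm \<Rightarrow> 'm \<Rightarrow> bool" where
  "commutative_square C i p a b \<longleftrightarrow> i \<in> Ar C \<and> p \<in> Ar C \<and>
    a \<in> hom C (Dom C i) (Dom C p) \<and> b \<in> hom C (Cod C i) (Cod C p) \<and>
    Comp C p a = Comp C b i"

definition is_lifting :: "('o, 'm) cat \<Rightarrow> 'm \<Rightarrow> 'm \<Rightarrow> 'm \<Rightarrow> 'm \<Rightarrow> 'm \<Rightarrow> bool" where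
  "is_lifting C i p a b s \<longleftrightarrow>
    s \<in> hom C (Cod C i) (Dom C p) \<and> Comp C s i = a \<and> Comp C p s = b"

locale model_structure = category A for A :: "('o, 'm) cat" +
  fixes CoFib Fib Weq :: "'m set"
  assumes CoFib_sub: "CoFib \<subseteq> Ar A" and Fib_sub: "Fib \<subseteq> Ar A" and Weq_sub: "Weq \<subseteq> Ar A"
    and CM1: "two_out_of_three A Weq"
    and CM2: "closed_under_retracts A CoFib" "closed_under_retracts A Fib"
      "closed_under_retracts A Weq"
    and CM3: "\<lbrakk>commutative_square A i p a b;
        i \<in> CoFib \<inter> Weq \<and> p \<in> Fib \<or> i \<in> CoFib \<and> p \<in> Fib \<inter> Weq\<rbrakk>
        \<Longrightarrow> \<exists>s. is_lifting A i p a b s"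
    and CM4_TCoFib_Fib: "f \<in> Ar A \<Longrightarrow>
        \<exists>i \<in> CoFib \<inter> Weq. \<exists>p \<in> Fib. Cod A i = Dom A p \<and> f = Comp A p i"
    and CM4_CoFib_TFib: "f \<in> Ar A \<Longrightarrow>
        \<exists>j \<in> CoFib. \<exists>q \<in> Fib \<inter> Weq. Cod A j = Dom A q \<and> f = Comp A q j"

locale orthogonal_model_structure = model_structure +
  assumes lifting_unique: "\<lbrakk>commutative_square A i p a b;
      i \<in> CoFib \<inter> Weq \<and> p \<in> Fib \<or> i \<in> CoFib \<and> p \<in> Fib \<inter> Weq;
      is_lifting A i p a b s; is_lifting A i p a b t\<rbrakk> \<Longrightarrow> s = t"

definition cofibrant :: "('o, 'm) cat \<Rightarrow> 'o \<Rightarrow> 'm set \<Rightarrow> 'o \<Rightarrow> bool" where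
  "cofibrant C z CoFib x \<longleftrightarrow> x \<in> Ob C \<and> (THE f. f \<in> hom C z x) \<in> CoFib"

definition fibrant :: "('o, 'm) cat \<Rightarrow> 'o \<Rightarrow> 'm set \<Rightarrow> 'o \<Rightarrow> bool" where
  "fibrant C z Fib x \<longleftrightarrow> x \<in> Ob C \<and> (THE f. f \<in> hom C x z) \<in> Fib"

section \<open>Localization\<close>

text \<open>
  The Gabriel--Zisman construction of \<open>C[W\<^sup>-\<^sup>1]\<close>: its objects are those of \<open>C\<close>, and its arrows
  are classes of zigzags of arrows of \<open>C\<close> and formal inverses of arrows in \<open>W\<close>. A zigzag is a
  list of steps in the order of travel, so \<open>[Fwd f, Fwd g]\<close> represents \<open>g\<close> after \<open>f\<close>. An arrow
  carries its end points, since the empty list does not determine them.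
\<close>

datatype 'm step = Fwd 'm | Bwd 'm

inductive zigzag ::
    "('o, 'm) cat \<Rightarrow> 'm set \<Rightarrow> 'o \<Rightarrow> 'm step list \<Rightarrow> 'o \<Rightarrow> bool" for C W where
  zz_Nil: "x \<in> Ob C \<Longrightarrow> zigzag C W x [] x"
| zz_Fwd: "\<lbrakk>f \<in> Ar C; zigzag C W (Cod C f) p y\<rbrakk> \<Longrightarrow> zigzag C W (Dom C f) (Fwd f # p) y"
| zz_Bwd: "\<lbrakk>w \<in> Ar C; w \<in> W; zigzag C W (Dom C w) p y\<rbrakk> \<Longrightarrow> zigzag C W (Cod C w) (Bwd w # p) y"

inductive zigzag_eq ::
    "('o, 'm) cat \<Rightarrow> 'm set \<Rightarrow> 'o \<Rightarrow> 'o \<Rightarrow> 'm step list \<Rightarrow> 'm step list \<Rightarrow> bool" for C W where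
  zq_refl: "zigzag C W x p y \<Longrightarrow> zigzag_eq C W x y p p"
| zq_sym: "zigzag_eq C W x y p q \<Longrightarrow> zigzag_eq C W x y q p"
| zq_trans: "\<lbrakk>zigzag_eq C W x y p q; zigzag_eq C W x y q r\<rbrakk> \<Longrightarrow> zigzag_eq C W x y p r"
| zq_append: "\<lbrakk>zigzag_eq C W x y p p'; zigzag_eq C W y z q q'\<rbrakk>
    \<Longrightarrow> zigzag_eq C W x z (p @ q) (p' @ q')"
| zq_Idn: "x \<in> Ob C \<Longrightarrow> zigzag_eq C W x x [Fwd (Idn C x)] []"
| zq_Comp: "\<lbrakk>f \<in> Ar C; g \<in> Ar C; Cod C f = Dom C g\<rbrakk>
    \<Longrightarrow> zigzag_eq C W (Dom C f) (Cod C g) [Fwd f, Fwd g] [Fwd (Comp C g f)]"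
| zq_Fwd_Bwd: "\<lbrakk>w \<in> Ar C; w \<in> W\<rbrakk> \<Longrightarrow> zigzag_eq C W (Dom C w) (Dom C w) [Fwd w, Bwd w] []"
| zq_Bwd_Fwd: "\<lbrakk>w \<in> Ar C; w \<in> W\<rbrakk> \<Longrightarrow> zigzag_eq C W (Cod C w) (Cod C w) [Bwd w, Fwd w] []"

definition zigzag_class ::
    "('o, 'm) cat \<Rightarrow> 'm set \<Rightarrow> 'o \<Rightarrow> 'o \<Rightarrow> 'm step list \<Rightarrow> 'o \<times> 'o \<times> 'm step list set" where
  "zigzag_class C W x y p = (x, y, {q. zigzag_eq C W x y p q})"

definition localization ::
    "('o, 'm) cat \<Rightarrow> 'm set \<Rightarrow> ('o, 'o \<times> 'o \<times> 'm step list set) cat" where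
  "localization C W =
    \<lparr>Ob = Ob C,
     Ar = {zigzag_class C W x y p |x y p. zigzag C W x p y},
     Dom = (\<lambda>(x, y, P). x),
     Cod = (\<lambda>(x, y, P). y),
     Idn = (\<lambda>x. zigzag_class C W x x []),
     Comp = (\<lambda>(y, z, Q) (x, y', P). (x, z, {r. \<exists>p \<in> P. \<exists>q \<in> Q. zigzag_eq C W x z (p @ q) r}))\<rparr>"

definition localization_ftor ::
    "('o, 'm) cat \<Rightarrow> 'm set \<Rightarrow> ('o, 'm, 'o, 'o \<times> 'o \<times> 'm step list set) ftor" where
  "localization_ftor C W =
    \<lparr>FOb = (\<lambda>x. x), FAr = (\<lambda>f. zigzag_class C W (Dom C f) (Cod C f) [Fwd f])\<rparr>"

definition homotopy_category ::
    "('o, 'm) cat \<Rightarrow> 'm set \<Rightarrow> ('o, 'o \<times> 'o \<times> 'm step list set) cat" where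
  "homotopy_category A Weq = localization A Weq"

subsection \<open>The universal property of the localization\<close>

text \<open>
  The lemmas below confirm that \<open>localization C W\<close> is a category, that \<open>localization_ftor C W\<close>
  inverts \<open>W\<close>, and that every functor on \<open>C\<close> inverting \<open>W\<close>, into a category of arbitrary
  type, factors through it strictly and uniquely.
\<close>

lemma zigzag_ends:
  assumes "category C" "zigzag C W x p y" shows "x \<in> Ob C" "y \<in> Ob C"
  using assms(2) by (induction) (auto simp: category.Dom_in[OF assms(1)] category.Cod_in[OF assms(1)])

lemma zigzag_append:
  "zigzag C W x p y \<Longrightarrow> zigzag C W y q z \<Longrightarrow> zigzag C W x (p @ q) z"
  by (induction rule: zigzag.induct) (auto intro: zigzag.intros)

lemma zigzag_single:
  assumes "category C" "f \<in> Ar C" shows "zigzag C W (Dom C f) [Fwd f] (Cod C f)"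
  using assms by (auto intro!: zigzag.intros category.Cod_in)

lemma zigzag_single_Bwd:
  assumes "category C" "w \<in> Ar C" "w \<in> W" shows "zigzag C W (Cod C w) [Bwd w] (Dom C w)"
  using assms by (auto intro!: zigzag.intros category.Dom_in)

lemma zigzag_eq_zigzag:
  assumes "category C" "zigzag_eq C W x y p q"
  shows "zigzag C W x p y \<and> zigzag C W x q y"
  using assms(2)
proof (induction)
  case (zq_Comp f g)
  interpret category C by fact
  have "zigzag C W (Dom C f) [Fwd (Comp C g f)] (Cod C g)"
    using zigzag_single[OF assms(1), of "Comp C g f"] zq_Comp by simp
  with zq_Comp show ?case
    using zz_Fwd[of f C W "[Fwd g]" "Cod C g"] zigzag_single[OF assms(1), of g] by auto
next
  case (zq_Idn x)
  interpret category C by fact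
  show ?case using zigzag_single[OF assms(1), of "Idn C x"] zq_Idn by (auto intro: zz_Nil)
next
  case (zq_Fwd_Bwd w)
  interpret category C by fact
  show ?case using zigzag_single_Bwd[OF assms(1)] zq_Fwd_Bwd by (auto intro!: zigzag.intros)
next
  case (zq_Bwd_Fwd w)
  interpret category C by fact
  show ?case using zigzag_single[OF assms(1)] zq_Bwd_Fwd by (auto intro!: zigzag.intros)
qed (auto intro: zigzag_append)

lemma zigzag_class_eq_iff:
  assumes "zigzag C W x p y"
  shows "zigzag_class C W x y p = zigzag_class C W x y q \<longleftrightarrow> zigzag_eq C W x y p q"
  unfolding zigzag_class_def
  using zq_refl[OF assms] by (auto intro: zq_sym zq_trans)

lemma localization_sel [simp]:
  "Ob (localization C W) = Ob C"
  "Ar (localization C W) = {zigzag_class C W x y p |x y p. zigzag C W x p y}"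
  "Dom (localization C W) (zigzag_class C W x y p) = x"
  "Cod (localization C W) (zigzag_class C W x y p) = y"
  "Idn (localization C W) x = zigzag_class C W x x []"
  by (auto simp: localization_def zigzag_class_def)

lemma localization_arrow:
  "zigzag C W x p y \<Longrightarrow>
    \<exists>x' y' p'. zigzag_class C W x y p = zigzag_class C W x' y' p' \<and> zigzag C W x' p' y'"
  by blast

lemma localization_Comp:
  assumes "zigzag C W x p y" "zigzag C W y q z"
  shows "Comp (localization C W) (zigzag_class C W y z q) (zigzag_class C W x y p)
    = zigzag_class C W x z (p @ q)"
proof -
  have "(\<exists>p'\<in>{p'. zigzag_eq C W x y p p'}. \<exists>q'\<in>{q'. zigzag_eq C W y z q q'}.
           zigzag_eq C W x z (p' @ q') r) \<longleftrightarrow> zigzag_eq C W x z (p @ q) r" for r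
    using zq_refl[OF assms(1)] zq_refl[OF assms(2)] by (blast intro: zq_trans zq_append)
  then show ?thesis by (simp add: localization_def zigzag_class_def)
qed

lemma category_localization:
  assumes "category C" shows "category (localization C W)"
proof
  fix f g h
  let ?L = "localization C W"
  assume f: "f \<in> Ar ?L" and g: "g \<in> Ar ?L" and h: "h \<in> Ar ?L"
    and e: "Cod ?L f = Dom ?L g" "Cod ?L g = Dom ?L h"
  obtain x y p where fp: "f = zigzag_class C W x y p" "zigzag C W x p y" using f by auto
  obtain z q where gq: "g = zigzag_class C W y z q" "zigzag C W y q z" using g e fp by auto
  obtain t r where hr: "h = zigzag_class C W z t r" "zigzag C W z r t" using h e gq by auto
  show "Comp ?L (Comp ?L h g) f = Comp ?L h (Comp ?L g f)"
    using fp gq hr by (simp add: localization_Comp zigzag_append)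
next
  fix f g
  let ?L = "localization C W"
  assume f: "f \<in> Ar ?L" and g: "g \<in> Ar ?L" and e: "Cod ?L f = Dom ?L g"
  obtain x y p where fp: "f = zigzag_class C W x y p" "zigzag C W x p y" using f by auto
  obtain z q where gq: "g = zigzag_class C W y z q" "zigzag C W y q z" using g e fp by auto
  have "zigzag C W x (p @ q) z" using fp gq by (blast intro: zigzag_append)
  then show "Comp ?L g f \<in> Ar ?L" "Dom ?L (Comp ?L g f) = Dom ?L f"
    "Cod ?L (Comp ?L g f) = Cod ?L g"
    using fp gq by (auto simp: localization_Comp)
qed (use zigzag_ends[OF assms] in
    \<open>auto simp: localization_Comp zz_Nil intro!: localization_arrow\<close>)

lemma is_ftor_localization_ftor:
  assumes "category C" shows "is_ftor C (localization C W) (localization_ftor C W)"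
proof -
  interpret category C by fact
  show ?thesis
    unfolding is_ftor_def
  proof (intro conjI ballI impI)
    fix f g assume f: "f \<in> Ar C" and g: "g \<in> Ar C" and e: "Cod C f = Dom C g"
    note zf = zigzag_single[OF assms f, of W, unfolded e] and zg = zigzag_single[OF assms g, of W]
    show "FAr (localization_ftor C W) (Comp C g f)
      = Comp (localization C W) (FAr (localization_ftor C W) g) (FAr (localization_ftor C W) f)"
      using zigzag_append[OF zf zg] zq_Comp[OF f g e, of W]
      by (simp add: localization_ftor_def localization_Comp[OF zf zg] e f g
          zigzag_class_eq_iff[symmetric] zq_refl)
  next
    fix x assume x: "x \<in> Ob C"
    show "FAr (localization_ftor C W) (Idn C x)
      = Idn (localization C W) (FOb (localization_ftor C W) x)"
      using zigzag_single[OF assms, of "Idn C x" W] zq_Idn[OF x, of W] x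
      by (simp add: localization_ftor_def zigzag_class_eq_iff)
  qed (use assms zigzag_single[OF assms] category_localization[OF assms] in
      \<open>auto simp: localization_ftor_def hom_def intro!: localization_arrow\<close>)
qed

lemma localization_inverts:
  assumes "category C" "w \<in> Ar C" "w \<in> W"
  shows "inverse_arrows (localization C W) (FAr (localization_ftor C W) w)
    (zigzag_class C W (Cod C w) (Dom C w) [Bwd w])"
proof -
  note F = zigzag_single[OF assms(1,2), of W] and B = zigzag_single_Bwd[OF assms]
  show ?thesis
    using F B zq_Fwd_Bwd[OF assms(2,3)] zq_Bwd_Fwd[OF assms(2,3)]
      zigzag_append[OF F B] zigzag_append[OF B F]
    by (auto simp: inverse_arrows_def localization_ftor_def hom_def localization_Comp[OF F B]
        localization_Comp[OF B F] zigzag_class_eq_iff)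
qed

lemma inverse_arrows_unique:
  assumes "category D" "inverse_arrows D f g" "inverse_arrows D f h" shows "g = h"
proof -
  interpret category D by fact
  have "g = Comp D g (Comp D f h)" "h = Comp D (Comp D g f) h"
    using assms(2,3) Comp_Idn_right[of g] Comp_Idn_left[of h]
    by (auto simp: inverse_arrows_def hom_def)
  then show ?thesis
    using assms(2,3) Comp_assoc[of h f g] by (auto simp: inverse_arrows_def hom_def)
qed

fun zigzag_eval ::
    "('o, 'm) cat \<Rightarrow> ('p, 'n) cat \<Rightarrow> ('o, 'm, 'p, 'n) ftor \<Rightarrow> 'o \<Rightarrow> 'm step list \<Rightarrow> 'n" where
  "zigzag_eval C D F x [] = Idn D (FOb F x)"
| "zigzag_eval C D F x (Fwd f # p) = Comp D (zigzag_eval C D F (Cod C f) p) (FAr F f)"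
| "zigzag_eval C D F x (Bwd w # p) =
    Comp D (zigzag_eval C D F (Dom C w) p) (THE g. inverse_arrows D (FAr F w) g)"

lemma the_inverse:
  assumes "category D" "inverse_arrows D f g" shows "(THE h. inverse_arrows D f h) = g"
  using assms by (blast intro: inverse_arrows_unique)

context
  fixes C :: "('o, 'm) cat" and D :: "('p, 'n) cat" and F and W
  assumes F: "is_ftor C D F" and inv: "\<And>w. w \<in> Ar C \<Longrightarrow> w \<in> W \<Longrightarrow> is_iso D (FAr F w)"
begin

interpretation C: category C using F by (simp add: is_ftor_def)
interpretation D: category D using F by (simp add: is_ftor_def)

private lemma FO: "x \<in> Ob C \<Longrightarrow> FOb F x \<in> Ob D"
  using F by (simp add: is_ftor_def)

private lemma FA:
  assumes "f \<in> Ar C"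
  shows "FAr F f \<in> Ar D" "Dom D (FAr F f) = FOb F (Dom C f)" "Cod D (FAr F f) = FOb F (Cod C f)"
  using F assms by (auto simp: is_ftor_def hom_def)

private lemma FI:
  assumes "w \<in> Ar C" "w \<in> W"
  defines "v \<equiv> THE g. inverse_arrows D (FAr F w) g"
  shows "inverse_arrows D (FAr F w) v"
    "v \<in> Ar D" "Dom D v = FOb F (Cod C w)" "Cod D v = FOb F (Dom C w)"
    "Comp D v (FAr F w) = Idn D (FOb F (Dom C w))" "Comp D (FAr F w) v = Idn D (FOb F (Cod C w))"
proof -
  obtain g where g: "inverse_arrows D (FAr F w) g" using inv[OF assms(1,2)] by (auto simp: is_iso_def)
  then have "v = g" by (simp add: v_def the_inverse[OF D.category_axioms])
  then show "inverse_arrows D (FAr F w) v" using g by simp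
  then show "v \<in> Ar D" "Dom D v = FOb F (Cod C w)" "Cod D v = FOb F (Dom C w)"
    "Comp D v (FAr F w) = Idn D (FOb F (Dom C w))" "Comp D (FAr F w) v = Idn D (FOb F (Cod C w))"
    using FA[OF assms(1)] by (auto simp: inverse_arrows_def hom_def)
qed

private lemma eval_hom:
  assumes "zigzag C W x p y"
  shows "zigzag_eval C D F x p \<in> Ar D \<and> Dom D (zigzag_eval C D F x p) = FOb F x \<and>
    Cod D (zigzag_eval C D F x p) = FOb F y"
  using assms by (induction) (simp_all add: FO FA FI)

private lemma eval_append:
  assumes "zigzag C W x p y" "zigzag C W y q z"
  shows "zigzag_eval C D F x (p @ q) = Comp D (zigzag_eval C D F y q) (zigzag_eval C D F x p)"
  using assms
proof (induction)
  case (zz_Nil x)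
  then show ?case using eval_hom[of x q z] D.Comp_Idn_right[of "zigzag_eval C D F x q"] by simp
next
  case (zz_Fwd f p y)
  then show ?case using eval_hom[of _ p y] eval_hom[of y q z] by (simp add: D.Comp_assoc FA)
next
  case (zz_Bwd w p y)
  then show ?case using eval_hom[of _ p y] eval_hom[of y q z] by (simp add: D.Comp_assoc FI)
qed

private lemma eval_Fwd: "f \<in> Ar C \<Longrightarrow> zigzag_eval C D F x [Fwd f] = FAr F f"
  using D.Comp_Idn_left[of "FAr F f"] by (simp add: FA)

private lemma eval_eq:
  assumes "zigzag_eq C W x y p q" shows "zigzag_eval C D F x p = zigzag_eval C D F x q"
  using assms
proof (induction)
  case (zq_append x y p p' z q q')
  have "zigzag C W x p y" "zigzag C W x p' y" "zigzag C W y q z" "zigzag C W y q' z"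
    using zigzag_eq_zigzag[OF C.category_axioms zq_append.hyps(1)]
      zigzag_eq_zigzag[OF C.category_axioms zq_append.hyps(2)] by auto
  then show ?case
    using zq_append.IH by (simp add: eval_append[of x _ y _ z])
next
  case (zq_Idn x)
  then show ?case using eval_Fwd[of "Idn C x" x] F by (simp add: is_ftor_def)
next
  case (zq_Comp f g)
  then have "zigzag_eval C D F (Dom C f) [Fwd f, Fwd g] = Comp D (FAr F g) (FAr F f)"
    using eval_Fwd[of g] by simp
  also have "\<dots> = FAr F (Comp C g f)" using F zq_Comp by (simp add: is_ftor_def)
  also have "\<dots> = zigzag_eval C D F (Dom C f) [Fwd (Comp C g f)]"
    using zq_Comp eval_Fwd[of "Comp C g f"] by simp
  finally show ?case .
next
  case (zq_Fwd_Bwd w)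
  let ?v = "THE g. inverse_arrows D (FAr F w) g"
  have "Comp D (Idn D (FOb F (Dom C w))) ?v = ?v"
    using D.Comp_Idn_left[of ?v] zq_Fwd_Bwd FI[of w] by simp
  then show ?case using FI[of w] zq_Fwd_Bwd by simp
next
  case (zq_Bwd_Fwd w)
  have "Comp D (Idn D (FOb F (Cod C w))) (FAr F w) = FAr F w"
    using D.Comp_Idn_left[of "FAr F w"] zq_Bwd_Fwd FA[of w] by simp
  then show ?case using FI[of w] zq_Bwd_Fwd by simp
qed auto

lemma localization_universal_existence:
  "\<exists>G. is_ftor (localization C W) D G \<and>
    (\<forall>x \<in> Ob C. FOb G x = FOb F x) \<and>
    (\<forall>f \<in> Ar C. FAr G (FAr (localization_ftor C W) f) = FAr F f)"
proof -
  define G :: "('o, 'o \<times> 'o \<times> 'm step list set, 'p, 'n) ftor" where "G =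
    \<lparr>FOb = FOb F, FAr = (\<lambda>(x, y, P). zigzag_eval C D F x (SOME p. p \<in> P))\<rparr>"
  have GO: "FOb G = FOb F" by (simp add: G_def)
  have GA: "FAr G (zigzag_class C W x y p) = zigzag_eval C D F x p" if "zigzag C W x p y" for x y p
  proof -
    have "zigzag_eq C W x y p (SOME q. zigzag_eq C W x y p q)"
      using zq_refl[OF that] by (rule someI)
    from eval_eq[OF this] show ?thesis by (simp add: G_def zigzag_class_def)
  qed
  have "is_ftor (localization C W) D G"
    unfolding is_ftor_def
  proof (intro conjI ballI impI)
    fix f g
    let ?L = "localization C W"
    assume f: "f \<in> Ar ?L" and g: "g \<in> Ar ?L" and e: "Cod ?L f = Dom ?L g"
    obtain x y p where fp: "f = zigzag_class C W x y p" "zigzag C W x p y" using f by auto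
    obtain z q where gq: "g = zigzag_class C W y z q" "zigzag C W y q z" using g e fp by auto
    show "FAr G (Comp ?L g f) = Comp D (FAr G g) (FAr G f)"
      using fp gq zigzag_append[OF fp(2) gq(2)]
      by (simp add: localization_Comp GA eval_append)
  qed (use eval_hom C.category_axioms D.category_axioms category_localization FO in
      \<open>auto simp: GO GA zz_Nil hom_def\<close>)
  moreover have "FAr G (FAr (localization_ftor C W) f) = FAr F f" if "f \<in> Ar C" for f
    using GA[OF zigzag_single[OF C.category_axioms that]] eval_Fwd[OF that]
    by (simp add: localization_ftor_def)
  ultimately show ?thesis using GO by auto
qed

lemma localization_universal_uniqueness:
  assumes "is_ftor (localization C W) D G" "is_ftor (localization C W) D H"
    and "\<forall>x \<in> Ob C. FOb G x = FOb F x" "\<forall>x \<in> Ob C. FOb H x = FOb F x"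
    and "\<forall>f \<in> Ar C. FAr G (FAr (localization_ftor C W) f) = FAr F f"
      "\<forall>f \<in> Ar C. FAr H (FAr (localization_ftor C W) f) = FAr F f"
  shows "\<forall>a \<in> Ar (localization C W). FAr G a = FAr H a"
proof -
  have eval: "FAr K (zigzag_class C W x y p) = zigzag_eval C D F x p"
    if K: "is_ftor (localization C W) D K" "\<forall>x \<in> Ob C. FOb K x = FOb F x"
      "\<forall>f \<in> Ar C. FAr K (FAr (localization_ftor C W) f) = FAr F f"
      and zz: "zigzag C W x p y" for K x y p
  proof -
    let ?L = "localization C W"
    interpret L: category ?L using K(1) by (simp add: is_ftor_def)
    have Kcomp: "FAr K (Comp ?L g f) = Comp D (FAr K g) (FAr K f)"
      if "f \<in> Ar ?L" "g \<in> Ar ?L" "Cod ?L f = Dom ?L g" for f g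
      using K(1) that unfolding is_ftor_def by blast
    have KI: "FAr K (Idn ?L x) = Idn D (FOb F x)" if "x \<in> Ob C" for x
      using K(1,2) that unfolding is_ftor_def by auto
    show ?thesis
      using zz
    proof (induction)
      case (zz_Nil x)
      then show ?case using KI[of x] by simp
    next
      case (zz_Fwd f p y)
      note z1 = zigzag_single[OF C.category_axioms zz_Fwd(1), of W]
      have "FAr K (zigzag_class C W (Dom C f) y (Fwd f # p)) =
        Comp D (FAr K (zigzag_class C W (Cod C f) y p))
          (FAr K (zigzag_class C W (Dom C f) (Cod C f) [Fwd f]))"
        using localization_Comp[OF z1 zz_Fwd(2)] z1 zz_Fwd(2) by (subst Kcomp[symmetric]) auto
      then show ?case using K(3) zz_Fwd by (simp add: localization_ftor_def)
    next
      case (zz_Bwd w p y)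
      note z1 = zigzag_single_Bwd[OF C.category_axioms zz_Bwd(1,2)]
      let ?w = "FAr (localization_ftor C W) w" and ?v = "zigzag_class C W (Cod C w) (Dom C w) [Bwd w]"
      have I: "inverse_arrows ?L ?w ?v"
        by (rule localization_inverts[OF C.category_axioms zz_Bwd(1,2)])
      have wv: "Dom ?L ?w = Dom C w" "Cod ?L ?w = Cod C w" by (simp_all add: localization_ftor_def)
      have w: "?w \<in> Ar ?L" "?v \<in> Ar ?L" "Cod ?L ?w = Dom ?L ?v" "Cod ?L ?v = Dom ?L ?w"
        "Comp ?L ?v ?w = Idn ?L (Dom C w)" "Comp ?L ?w ?v = Idn ?L (Cod C w)"
        using I wv by (auto simp: inverse_arrows_def hom_def)
      have "FAr K ?v \<in> hom D (FOb K (Dom ?L ?v)) (FOb K (Cod ?L ?v))"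
        using K(1) w(2) unfolding is_ftor_def by blast
      then have v: "FAr K ?v \<in> hom D (FOb F (Cod C w)) (FOb F (Dom C w))"
        using K(2) zz_Bwd(1) by simp
      have "inverse_arrows D (FAr F w) (FAr K ?v)"
        using Kcomp[OF w(1,2,3)] Kcomp[OF w(2,1,4)] K(3) zz_Bwd(1) v KI
        by (simp add: inverse_arrows_def FA w(5,6) del: localization_sel(5))
      then have "FAr K ?v = (THE g. inverse_arrows D (FAr F w) g)"
        by (simp add: the_inverse[OF D.category_axioms])
      moreover have "FAr K (zigzag_class C W (Cod C w) y (Bwd w # p)) =
        Comp D (FAr K (zigzag_class C W (Dom C w) y p)) (FAr K ?v)"
        using localization_Comp[OF z1 zz_Bwd(3)] z1 zz_Bwd(3) by (subst Kcomp[symmetric]) auto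
      ultimately show ?case using zz_Bwd by simp
    qed
  qed
  show ?thesis using eval[OF assms(1,3,5)] eval[OF assms(2,4,6)] by auto
qed

end

end

theory Submission
  imports Defs
begin

text \<open>
  Unique lifting makes a trivial fibration \<open>q\<^sub>X : QX \<rightarrow> X\<close> from a cofibrant object a coreflection
  and a trivial cofibration \<open>i\<^sub>X : QX \<rightarrow> RX\<close> to a fibrant object a reflection, so \<open>X \<mapsto> RX\<close> is a
  functor on the nose, without passing to homotopy classes. A weak equivalence between
  cofibrant-fibrant objects is an isomorphism, hence this functor factors through the localization.
  The factorization is quasi-inverse to the inclusion: on the localization via
  \<open>q\<^sub>X \<circ> i\<^sub>X\<^sup>-\<^sup>1\<close>, and on a cofibrant-fibrant object via the extension of \<open>q\<^sub>X\<close> along \<open>i\<^sub>X\<close>.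
\<close>

section \<open>Composition and isomorphisms in terms of hom-sets\<close>

context category
begin

lemma hom_comp: "\<lbrakk>f \<in> hom C x y; g \<in> hom C y w\<rbrakk> \<Longrightarrow> g \<cdot> f \<in> hom C x w"
  by (auto simp: hom_def)

text \<open>With typing facts of the form \<open>f \<in> hom C x y\<close>, every composability
  condition is settled by instantiation, so later rebracketings need no side computation.\<close>

lemma hom_assoc:
  "\<lbrakk>f \<in> hom C x y; g \<in> hom C y w; h \<in> hom C w v\<rbrakk> \<Longrightarrow> (h \<cdot> g) \<cdot> f = h \<cdot> (g \<cdot> f)"
  by (auto simp: hom_def Comp_assoc)

lemma hom_Idn: "x \<in> Ob C \<Longrightarrow> Idn C x \<in> hom C x x"
  by (simp add: hom_def)

lemma hom_Idn_right: "f \<in> hom C x y \<Longrightarrow> f \<cdot> Idn C x = f"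
  by (auto simp: hom_def)

lemma hom_Idn_left: "f \<in> hom C x y \<Longrightarrow> Idn C y \<cdot> f = f"
  by (auto simp: hom_def)

lemma hom_Ob: "f \<in> hom C x y \<Longrightarrow> x \<in> Ob C" "f \<in> hom C x y \<Longrightarrow> y \<in> Ob C"
  by (auto simp: hom_def)

lemma hom_self: "f \<in> Ar C \<Longrightarrow> f \<in> hom C (Dom C f) (Cod C f)"
  by (simp add: hom_def)

lemma inverse_arrows_hom:
  assumes "f \<in> hom C x y"
  shows "inverse_arrows C f g \<longleftrightarrow> g \<in> hom C y x \<and> g \<cdot> f = Idn C x \<and> f \<cdot> g = Idn C y"
  using assms by (auto simp: inverse_arrows_def hom_def)

lemma is_iso_comp:
  assumes f: "f \<in> hom C x y" and g: "g \<in> hom C y w" and "is_iso C f" "is_iso C g"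
  shows "is_iso C (g \<cdot> f)"
proof -
  obtain f' where f': "f' \<in> hom C y x" "f' \<cdot> f = Idn C x" "f \<cdot> f' = Idn C y"
    using assms(3) inverse_arrows_hom[OF f] by (auto simp: is_iso_def)
  obtain g' where g': "g' \<in> hom C w y" "g' \<cdot> g = Idn C y" "g \<cdot> g' = Idn C w"
    using assms(4) inverse_arrows_hom[OF g] by (auto simp: is_iso_def)
  have "(f' \<cdot> g') \<cdot> (g \<cdot> f) = f' \<cdot> ((g' \<cdot> g) \<cdot> f)"
    using hom_assoc[OF hom_comp[OF f g] g'(1) f'(1)] hom_assoc[OF f g g'(1)] by simp
  then have 1: "(f' \<cdot> g') \<cdot> (g \<cdot> f) = Idn C x"
    using f' g' hom_Idn_left[OF f] by simp
  have "(g \<cdot> f) \<cdot> (f' \<cdot> g') = g \<cdot> ((f \<cdot> f') \<cdot> g')"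
    using hom_assoc[OF hom_comp[OF g'(1) f'(1)] f g] hom_assoc[OF g'(1) f'(1) f] by simp
  then have 2: "(g \<cdot> f) \<cdot> (f' \<cdot> g') = Idn C w"
    using f' g' hom_Idn_left[OF g'(1)] by simp
  show ?thesis
    unfolding is_iso_def inverse_arrows_hom[OF hom_comp[OF f g]]
    using 1 2 hom_comp[OF g'(1) f'(1)] by blast
qed

lemma iso_cancel_right:
  assumes f: "f \<in> hom C x y" "is_iso C f" and g: "g \<in> hom C y w" "h \<in> hom C y w"
    and e: "g \<cdot> f = h \<cdot> f"
  shows "g = h"
proof -
  obtain f' where f': "f' \<in> hom C y x" "f \<cdot> f' = Idn C y"
    using f inverse_arrows_hom[OF f(1)] by (auto simp: is_iso_def)
  have "g = (g \<cdot> f) \<cdot> f'" "h = (h \<cdot> f) \<cdot> f'"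
    using hom_assoc[OF f'(1) f(1)] g hom_Idn_right f'(2) by metis+
  then show ?thesis using e by simp
qed

lemma category_full_subcategory: "category (full_subcategory C S)"
  by (unfold_locales) (auto simp: full_subcategory_def Comp_assoc)

end

section \<open>Full subcategories, their isomorphisms, and functors\<close>

lemma full_subcategory_sel [simp]:
  "Ob (full_subcategory C S) = Ob C \<inter> S"
  "Ar (full_subcategory C S) = {f \<in> Ar C. Dom C f \<in> S \<and> Cod C f \<in> S}"
  "Dom (full_subcategory C S) = Dom C"
  "Cod (full_subcategory C S) = Cod C"
  "Idn (full_subcategory C S) = Idn C"
  "Comp (full_subcategory C S) = Comp C"
  by (simp_all add: full_subcategory_def)

lemma hom_full_subcategory:
  "\<lbrakk>x \<in> S; y \<in> S\<rbrakk> \<Longrightarrow> hom (full_subcategory C S) x y = hom C x y"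
  by (auto simp: hom_def)

text \<open>By fullness an inverse in the ambient category already lies in the subcategory, so
  isomorphisms found in \<open>A\<close> may be used in the subcategory of cofibrant-fibrant
  objects.\<close>

lemma is_iso_full_subcategory:
  assumes "Dom C f \<in> S" "Cod C f \<in> S"
  shows "is_iso (full_subcategory C S) f \<longleftrightarrow> is_iso C f"
  using assms by (simp add: is_iso_def inverse_arrows_def hom_full_subcategory)

lemma is_ftor_comp:
  assumes "is_ftor C D F" "is_ftor D E G" shows "is_ftor C E (comp_ftor G F)"
proof -
  have F: "category C" "\<And>x. x \<in> Ob C \<Longrightarrow> FOb F x \<in> Ob D"
    "\<And>f. f \<in> Ar C \<Longrightarrow> FAr F f \<in> Ar D \<and> Dom D (FAr F f) = FOb F (Dom C f)
      \<and> Cod D (FAr F f) = FOb F (Cod C f)"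
    using assms(1) by (auto simp: is_ftor_def hom_def)
  show ?thesis
    using assms F unfolding is_ftor_def comp_ftor_def by (auto simp: hom_def)
qed

lemma is_ftor_id: "category C \<Longrightarrow> is_ftor C C id_ftor"
  by (simp add: is_ftor_def id_ftor_def hom_def)

text \<open>The record \<open>id_ftor\<close> carries no source or target, so it serves as the
  inclusion as well as the identity functor.\<close>

lemma is_ftor_inclusion:
  assumes "category C" shows "is_ftor (full_subcategory C S) C id_ftor"
  using assms category.category_full_subcategory[OF assms]
  by (simp add: is_ftor_def id_ftor_def hom_def)

section \<open>Natural transformations between functors on a localization\<close>

text \<open>Naturality has to be tested only on images of arrows of \<open>C\<close>. The arrows
  whose naturality square commutes (predicate \<open>N\<close>) are closed under composition and
  under inverses, and every zigzag is a composite of images of arrows of \<open>C\<close> and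
  inverses of images of arrows of \<open>W\<close>.\<close>

lemma localization_natural:
  fixes C :: "('o, 'm) cat" and W :: "'m set"
  defines "L \<equiv> localization C W" and "l \<equiv> FAr (localization_ftor C W)"
  assumes C: "category C"
    and H: "is_ftor L D H" and K: "is_ftor L D K"
    and \<eta>: "\<And>x. x \<in> Ob C \<Longrightarrow> \<eta> x \<in> hom D (FOb H x) (FOb K x)"
    and nat: "\<And>f. f \<in> Ar C \<Longrightarrow>
      Comp D (\<eta> (Cod C f)) (FAr H (l f)) = Comp D (FAr K (l f)) (\<eta> (Dom C f))"
    and a: "a \<in> Ar L"
  shows "Comp D (\<eta> (Cod L a)) (FAr H a) = Comp D (FAr K a) (\<eta> (Dom L a))"
proof -
  interpret C: category C by fact
  interpret L: category L using H by (simp add: is_ftor_def)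
  interpret D: category D using H by (simp add: is_ftor_def)
  define N where "N a \<longleftrightarrow> Comp D (\<eta> (Cod L a)) (FAr H a) = Comp D (FAr K a) (\<eta> (Dom L a))" for a
  have ftor_hom: "FAr T f \<in> hom D (FOb T x) (FOb T y)"
    if "is_ftor L D T" "f \<in> hom L x y" for T f x y
    using that by (auto simp: is_ftor_def hom_def)
  have ftor_comp: "FAr T (Comp L g f) = Comp D (FAr T g) (FAr T f)"
    if "is_ftor L D T" "f \<in> hom L x y" "g \<in> hom L y w" for T f g x y w
    using that by (auto simp: is_ftor_def hom_def)
  have ftor_Idn: "FAr T (Idn L x) = Idn D (FOb T x)"
    if "is_ftor L D T" "x \<in> Ob C" for T x
    using that by (auto simp: is_ftor_def L_def simp del: localization_sel(5))
  have N_comp: "N (Comp L g f)" if "N f" "N g" and f: "f \<in> hom L x y" and g: "g \<in> hom L y w" for f g x y w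
  proof -
    have O: "x \<in> Ob C" "y \<in> Ob C" "w \<in> Ob C"
      using L.hom_Ob[OF f] L.hom_Ob[OF g] by (simp_all add: L_def)
    note Hf = ftor_hom[OF H f] and Hg = ftor_hom[OF H g]
      and Kf = ftor_hom[OF K f] and Kg = ftor_hom[OF K g]
    have "Comp D (\<eta> w) (Comp D (FAr H g) (FAr H f)) = Comp D (Comp D (FAr K g) (\<eta> y)) (FAr H f)"
      using D.hom_assoc[OF Hf Hg \<eta>[OF O(3)]] \<open>N g\<close> g by (simp add: N_def hom_def)
    also have "\<dots> = Comp D (FAr K g) (Comp D (FAr K f) (\<eta> x))"
      using D.hom_assoc[OF Hf \<eta>[OF O(2)] Kg] \<open>N f\<close> f by (simp add: N_def hom_def)
    also have "\<dots> = Comp D (Comp D (FAr K g) (FAr K f)) (\<eta> x)"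
      using D.hom_assoc[OF \<eta>[OF O(1)] Kf Kg] by simp
    finally show ?thesis
      using L.hom_comp[OF f g] ftor_comp[OF H f g] ftor_comp[OF K f g] by (simp add: N_def hom_def)
  qed
  \<comment> \<open>The square of \<open>g\<close> is that of \<open>f\<close> composed with
    \<open>FAr K g\<close> on one side and \<open>FAr H g\<close> on the other; these are one-sided
    inverses of \<open>FAr K f\<close> and \<open>FAr H f\<close>, which is all the computation
    uses.\<close>
  have N_inv: "N g" if "N f" and f: "f \<in> hom L x y" and g: "g \<in> hom L y x"
    and gf: "Comp L g f = Idn L x" "Comp L f g = Idn L y" for f g x y
  proof -
    have O: "x \<in> Ob C" "y \<in> Ob C"
      using L.hom_Ob[OF f] by (simp_all add: L_def)
    note Hf = ftor_hom[OF H f] and Hg = ftor_hom[OF H g]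
      and Kf = ftor_hom[OF K f] and Kg = ftor_hom[OF K g]
      and \<eta>x = \<eta>[OF O(1)] and \<eta>y = \<eta>[OF O(2)]
    have inv: "Comp D (FAr K g) (FAr K f) = Idn D (FOb K x)" "Comp D (FAr H f) (FAr H g) = Idn D (FOb H y)"
      using ftor_comp[OF K f g] ftor_comp[OF H g f] gf ftor_Idn[OF K O(1)] ftor_Idn[OF H O(2)] by simp_all
    have "Comp D (\<eta> x) (FAr H g) = Comp D (Comp D (Comp D (FAr K g) (FAr K f)) (\<eta> x)) (FAr H g)"
      using inv D.hom_Idn_left[OF \<eta>x] by simp
    also have "\<dots> = Comp D (FAr K g) (Comp D (Comp D (FAr K f) (\<eta> x)) (FAr H g))"
      using D.hom_assoc[OF \<eta>x Kf Kg] D.hom_assoc[OF Hg D.hom_comp[OF \<eta>x Kf] Kg] by simp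
    also have "\<dots> = Comp D (FAr K g) (Comp D (Comp D (\<eta> y) (FAr H f)) (FAr H g))"
      using \<open>N f\<close> f by (simp add: N_def hom_def)
    also have "\<dots> = Comp D (FAr K g) (\<eta> y)"
      using D.hom_assoc[OF Hg Hf \<eta>y] inv D.hom_Idn_right[OF \<eta>y] by simp
    finally show ?thesis using g by (simp add: N_def hom_def)
  qed
  have N_l: "N (l f)" if "f \<in> Ar C" for f
    using nat[OF that] by (simp add: N_def l_def L_def localization_ftor_def)
  have class_hom: "zigzag_class C W x y p \<in> hom L x y" if "zigzag C W x p y" for x y p
    using that by (auto simp: hom_def L_def)
  have "N (zigzag_class C W x y p)" if "zigzag C W x p y" for x y p
    using that
  proof (induction)
    case (zz_Nil x)
    then have "N (Idn L x)"
      using ftor_Idn[OF H] ftor_Idn[OF K] D.hom_Idn_right[OF \<eta>] D.hom_Idn_left[OF \<eta>]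
        L.hom_Idn[of x]
      by (simp add: N_def hom_def L_def)
    then show ?case by (simp add: L_def)
  next
    case (zz_Fwd f p y)
    note z = zigzag_single[OF C zz_Fwd(1), of W]
    have "N (zigzag_class C W (Dom C f) (Cod C f) [Fwd f])"
      using N_l[OF zz_Fwd(1)] by (simp add: l_def localization_ftor_def)
    from N_comp[OF this zz_Fwd(3) class_hom[OF z] class_hom[OF zz_Fwd(2)]]
    show ?case using localization_Comp[OF z zz_Fwd(2)] by (simp add: L_def)
  next
    case (zz_Bwd w p y)
    note z = zigzag_single_Bwd[OF C zz_Bwd(1,2)] and z' = zigzag_single[OF C zz_Bwd(1), of W]
    have lw: "l w = zigzag_class C W (Dom C w) (Cod C w) [Fwd w]"
      by (simp add: l_def localization_ftor_def)
    have "inverse_arrows L (l w) (zigzag_class C W (Cod C w) (Dom C w) [Bwd w])"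
      using localization_inverts[OF C zz_Bwd(1,2)] by (simp add: L_def l_def)
    then have "N (zigzag_class C W (Cod C w) (Dom C w) [Bwd w])"
      using N_inv[OF N_l[OF zz_Bwd(1)] class_hom[OF z', folded lw] class_hom[OF z]]
        L.inverse_arrows_hom[OF class_hom[OF z', folded lw]] by blast
    from N_comp[OF this zz_Bwd(4) class_hom[OF z] class_hom[OF zz_Bwd(3)]]
    show ?case using localization_Comp[OF z zz_Bwd(3)] by (simp add: L_def)
  qed
  then show ?thesis using a by (auto simp: N_def L_def)
qed

section \<open>Closure of the three classes under composition\<close>

context model_structure
begin

text \<open>The axioms do not list closure of \<open>Fib\<close> under composition; it follows by
  the retract argument. Factor the composite as \<open>q\<close> after a trivial cofibration
  \<open>i\<close>; lifting \<open>i\<close> first against \<open>p'\<close> and then against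
  \<open>p\<close> exhibits the composite as a retract of the fibration \<open>q\<close>.\<close>

lemma Fib_comp:
  assumes p: "p \<in> Fib" "p \<in> hom A x y" and p': "p' \<in> Fib" "p' \<in> hom A y z"
  shows "Comp A p' p \<in> Fib"
proof -
  note pp = hom_comp[OF p(2) p'(2)]
  obtain i q where i: "i \<in> CoFib \<inter> Weq" and q: "q \<in> Fib" and iq: "Cod A i = Dom A q"
    "Comp A p' p = Comp A q i"
    using CM4_TCoFib_Fib[of "Comp A p' p"] pp by (auto simp: hom_def)
  define w where "w = Cod A i"
  have Ar: "i \<in> Ar A" "q \<in> Ar A" using i q CoFib_sub Fib_sub by auto
  have "Dom A (Comp A q i) = x" "Cod A (Comp A q i) = z" using pp iq by (auto simp: hom_def)
  then have ih: "i \<in> hom A x w" and qh: "q \<in> hom A w z"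
    using Ar iq by (auto simp: hom_def w_def)
  have "commutative_square A i p' p q"
    using ih qh p p' iq by (auto simp: commutative_square_def hom_def)
  then obtain t where "is_lifting A i p' p q t" using CM3 i p'(1) by blast
  then have t: "t \<in> hom A w y" "Comp A t i = p" "Comp A p' t = q"
    using ih p' by (auto simp: is_lifting_def hom_def)
  have "x \<in> Ob A" using hom_Ob[OF p(2)] by simp
  \<comment> \<open>The first lifting \<open>t\<close> becomes the lower edge of a second square,
    whose upper edge is the identity. Its lifting \<open>s\<close> is a retraction of
    \<open>i\<close>, and composing it with \<open>p\<close> and \<open>p'\<close> gives
    \<open>q\<close>.\<close>
  then have "commutative_square A i p (Idn A x) t"
    using ih t p hom_Idn_right[OF p(2)] by (auto simp: commutative_square_def hom_def)
  then obtain s where "is_lifting A i p (Idn A x) t s" using CM3 i p(1) by blast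
  then have s: "s \<in> hom A w x" "Comp A s i = Idn A x" "Comp A p s = t"
    using ih p by (auto simp: is_lifting_def hom_def)
  have z: "z \<in> Ob A" using hom_Ob[OF p'(2)] by simp
  have "is_retract_of A (Comp A p' p) q"
    unfolding is_retract_of_def
  proof (intro conjI exI)
    show "i \<in> hom A (Dom A (Comp A p' p)) (Dom A q)" "s \<in> hom A (Dom A q) (Dom A (Comp A p' p))"
      "Idn A z \<in> hom A (Cod A (Comp A p' p)) (Cod A q)"
      "Idn A z \<in> hom A (Cod A q) (Cod A (Comp A p' p))"
      "Comp A s i = Idn A (Dom A (Comp A p' p))"
      using pp ih qh s(1,2) hom_Idn[OF z] by (auto simp: hom_def)
    show "Comp A (Idn A z) (Idn A z) = Idn A (Cod A (Comp A p' p))"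
      using pp hom_Idn_left[OF hom_Idn[OF z]] by (auto simp: hom_def)
    show "Comp A q i = Comp A (Idn A z) (Comp A p' p)"
      using iq hom_Idn_left[OF pp] by simp
    show "Comp A (Comp A p' p) s = Comp A (Idn A z) q"
      using hom_Idn_left[OF qh] hom_assoc[OF s(1) p(2) p'(2)] s t by simp
  qed (use pp Ar in \<open>auto simp: hom_def\<close>)
  then show ?thesis using CM2(2) q unfolding closed_under_retracts_def by blast
qed

text \<open>Dual retract argument: the composite is factored as a trivial fibration \<open>q\<close>
  after a cofibration \<open>i\<close>. Lifting \<open>j\<close> and then \<open>j'\<close> against
  \<open>q\<close> yields a section \<open>s\<close> of \<open>q\<close>, and \<open>s\<close>,
  \<open>q\<close> on codomains with identities on domains make the composite a retract of
  \<open>i\<close>.\<close>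

lemma CoFib_comp:
  assumes j: "j \<in> CoFib" "j \<in> hom A x y" and j': "j' \<in> CoFib" "j' \<in> hom A y z"
  shows "Comp A j' j \<in> CoFib"
proof -
  note jj = hom_comp[OF j(2) j'(2)]
  obtain i q where i: "i \<in> CoFib" and q: "q \<in> Fib \<inter> Weq" and iq: "Cod A i = Dom A q"
    "Comp A j' j = Comp A q i"
    using CM4_CoFib_TFib[of "Comp A j' j"] jj by (auto simp: hom_def)
  define w where "w = Cod A i"
  have Ar: "i \<in> Ar A" "q \<in> Ar A" using i q CoFib_sub Fib_sub by auto
  have "Dom A (Comp A q i) = x" "Cod A (Comp A q i) = z" using jj iq by (auto simp: hom_def)
  then have ih: "i \<in> hom A x w" and qh: "q \<in> hom A w z"
    using Ar iq by (auto simp: hom_def w_def)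
  have "commutative_square A j q i j'"
    using ih qh j j' iq by (auto simp: commutative_square_def hom_def)
  then obtain t where "is_lifting A j q i j' t" using CM3 q j(1) by blast
  then have t: "t \<in> hom A y w" "Comp A t j = i" "Comp A q t = j'"
    using qh j by (auto simp: is_lifting_def hom_def)
  have z: "z \<in> Ob A" using hom_Ob[OF j'(2)] by simp
  then have "commutative_square A j' q t (Idn A z)"
    using qh t j' hom_Idn_left[OF j'(2)] by (auto simp: commutative_square_def hom_def)
  then obtain s where "is_lifting A j' q t (Idn A z) s" using CM3 q j'(1) by blast
  then have s: "s \<in> hom A z w" "Comp A s j' = t" "Comp A q s = Idn A z"
    using qh j' by (auto simp: is_lifting_def hom_def)
  have x: "x \<in> Ob A" using hom_Ob[OF j(2)] by simp
  have "is_retract_of A (Comp A j' j) i"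
    unfolding is_retract_of_def
  proof (intro conjI exI)
    show "Idn A x \<in> hom A (Dom A (Comp A j' j)) (Dom A i)"
      "Idn A x \<in> hom A (Dom A i) (Dom A (Comp A j' j))"
      "s \<in> hom A (Cod A (Comp A j' j)) (Cod A i)" "q \<in> hom A (Cod A i) (Cod A (Comp A j' j))"
      "Comp A q s = Idn A (Cod A (Comp A j' j))"
      using jj ih qh s(1,3) hom_Idn[OF x] by (auto simp: hom_def)
    show "Comp A (Idn A x) (Idn A x) = Idn A (Dom A (Comp A j' j))"
      using jj hom_Idn_left[OF hom_Idn[OF x]] by (auto simp: hom_def)
    show "Comp A i (Idn A x) = Comp A s (Comp A j' j)"
      using hom_Idn_right[OF ih] hom_assoc[OF j(2) j'(2) s(1)] s t by simp
    show "Comp A (Comp A j' j) (Idn A x) = Comp A q i"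
      using iq hom_Idn_right[OF jj] by simp
  qed (use jj Ar in \<open>auto simp: hom_def\<close>)
  then show ?thesis using CM2(1) i unfolding closed_under_retracts_def by blast
qed

lemma Weq_comp:
  assumes "f \<in> hom A x y" "g \<in> hom A y w"
  shows "\<lbrakk>f \<in> Weq; g \<in> Weq\<rbrakk> \<Longrightarrow> Comp A g f \<in> Weq"
    and "\<lbrakk>f \<in> Weq; Comp A g f \<in> Weq\<rbrakk> \<Longrightarrow> g \<in> Weq"
    and "\<lbrakk>g \<in> Weq; Comp A g f \<in> Weq\<rbrakk> \<Longrightarrow> f \<in> Weq"
  using CM1 assms unfolding two_out_of_three_def hom_def by auto

end

section \<open>Unique lifting at cofibrant and fibrant objects\<close>

locale pointed_orthogonal_model_structure = orthogonal_model_structure +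
  fixes z
  assumes zero: "zero_object A z"
begin

abbreviation "cof \<equiv> cofibrant A z CoFib"
abbreviation "fib \<equiv> fibrant A z Fib"
abbreviation "CF \<equiv> {x. cof x \<and> fib x}"

lemma zero_hom_unique:
  "\<lbrakk>f \<in> hom A z x; g \<in> hom A z x\<rbrakk> \<Longrightarrow> f = g"
  "\<lbrakk>f \<in> hom A x z; g \<in> hom A x z\<rbrakk> \<Longrightarrow> f = g"
  using zero hom_Ob unfolding zero_object_def by blast+

text \<open>Eliminates the definite description: arrows out of \<open>z\<close> are unique, so any
  cofibration from \<open>z\<close> to \<open>x\<close>, however it was found, witnesses
  cofibrancy.\<close>

lemma cofibrant_iff: "cof x \<longleftrightarrow> (\<exists>f \<in> hom A z x. f \<in> CoFib)"
proof -
  have "(THE f. f \<in> hom A z x) = f" if "f \<in> hom A z x" for f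
    using that zero_hom_unique(1) by blast
  moreover have "\<exists>f. f \<in> hom A z x" if "x \<in> Ob A"
    using that zero unfolding zero_object_def by blast
  ultimately show ?thesis using hom_Ob(2) unfolding cofibrant_def by metis
qed

lemma fibrant_iff: "fib x \<longleftrightarrow> (\<exists>f \<in> hom A x z. f \<in> Fib)"
proof -
  have "(THE f. f \<in> hom A x z) = f" if "f \<in> hom A x z" for f
    using that zero_hom_unique(2) by blast
  moreover have "\<exists>f. f \<in> hom A x z" if "x \<in> Ob A"
    using that zero unfolding zero_object_def by blast
  ultimately show ?thesis using hom_Ob(1) unfolding fibrant_def by metis
qed

lemma CF_Ob: "x \<in> CF \<Longrightarrow> x \<in> Ob A"
  by (simp add: cofibrant_def)

lemma cofibrant_comp: "\<lbrakk>cof x; j \<in> CoFib; j \<in> hom A x y\<rbrakk> \<Longrightarrow> cof y"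
  unfolding cofibrant_iff using CoFib_comp hom_comp by blast

lemma fibrant_comp: "\<lbrakk>fib y; p \<in> Fib; p \<in> hom A x y\<rbrakk> \<Longrightarrow> fib x"
  unfolding fibrant_iff using Fib_comp hom_comp by blast

text \<open>This is the coreflection property of trivial fibrations with respect to cofibrant
  objects. Lift the cofibration from \<open>z\<close> to \<open>c\<close> against \<open>p\<close>:
  the square commutes because arrows out of \<open>z\<close> are unique, and orthogonality makes the
  lifting unique.\<close>

lemma cofibrant_lift:
  assumes c: "cof c" and p: "p \<in> Fib \<inter> Weq" "p \<in> hom A x y" and f: "f \<in> hom A c y"
  shows "\<exists>!g. g \<in> hom A c x \<and> Comp A p g = f"
proof -
  obtain k where k: "k \<in> hom A z c" "k \<in> CoFib" using c cofibrant_iff by blast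
  obtain a where a: "a \<in> hom A z x"
    using zero hom_Ob[OF p(2)] unfolding zero_object_def by blast
  have "Comp A p a = Comp A f k"
    using zero_hom_unique(1) hom_comp[OF a p(2)] hom_comp[OF k(1) f] by blast
  then have sq: "commutative_square A k p a f"
    using k p f a by (auto simp: commutative_square_def hom_def)
  \<comment> \<open>The upper triangle of a lifting starts at \<open>z\<close> and so commutes
    automatically; only the factorization of \<open>f\<close> through \<open>p\<close>
    remains.\<close>
  have lift: "is_lifting A k p a f g \<longleftrightarrow> g \<in> hom A c x \<and> Comp A p g = f" for g
    using zero_hom_unique(1)[OF _ a] hom_comp[OF k(1)] k p by (auto simp: is_lifting_def hom_def)
  have "\<exists>s. is_lifting A k p a f s" using CM3[OF sq] k p by blast
  moreover have "s = t" if "is_lifting A k p a f s" "is_lifting A k p a f t" for s t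
    using lifting_unique[OF sq _ that] k p by blast
  ultimately show ?thesis unfolding lift by blast
qed

text \<open>Dual reflection property: here the square ends at \<open>z\<close>, so its commutativity
  and the lower triangle of a lifting are automatic.\<close>

lemma fibrant_extend:
  assumes y: "fib y" and i: "i \<in> CoFib \<inter> Weq" "i \<in> hom A c x" and f: "f \<in> hom A c y"
  shows "\<exists>!g. g \<in> hom A x y \<and> Comp A g i = f"
proof -
  obtain k where k: "k \<in> hom A y z" "k \<in> Fib" using y fibrant_iff by blast
  obtain b where b: "b \<in> hom A x z"
    using zero hom_Ob[OF i(2)] unfolding zero_object_def by blast
  have "Comp A k f = Comp A b i"
    using zero_hom_unique(2) hom_comp[OF i(2) b] hom_comp[OF f k(1)] by blast
  then have sq: "commutative_square A i k f b"
    using k i f b by (auto simp: commutative_square_def hom_def)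
  have lift: "is_lifting A i k f b g \<longleftrightarrow> g \<in> hom A x y \<and> Comp A g i = f" for g
    using zero_hom_unique(2)[OF _ b] hom_comp[OF _ k(1)] k i by (auto simp: is_lifting_def hom_def)
  have "\<exists>s. is_lifting A i k f b s" using CM3[OF sq] k i by blast
  moreover have "s = t" if "is_lifting A i k f b s" "is_lifting A i k f b t" for s t
    using lifting_unique[OF sq _ that] k i by blast
  ultimately show ?thesis unfolding lift by blast
qed

text \<open>Cofibrancy of \<open>y\<close> lifts the identity to a section \<open>s\<close> of
  \<open>p\<close>. Both \<open>s\<close> after \<open>p\<close> and the identity of
  \<open>x\<close> are lifts of \<open>p\<close> through \<open>p\<close>, so they agree because
  \<open>x\<close> is cofibrant.\<close>

lemma TFib_cofibrant_iso:
  assumes "cof x" "cof y" and p: "p \<in> Fib \<inter> Weq" "p \<in> hom A x y"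
  shows "is_iso A p"
proof -
  have O: "x \<in> Ob A" "y \<in> Ob A" using hom_Ob[OF p(2)] by auto
  obtain s where s: "s \<in> hom A y x" "Comp A p s = Idn A y"
    using cofibrant_lift[OF assms(2) p hom_Idn[OF O(2)]] by blast
  have "Comp A p (Comp A s p) = p"
    using hom_assoc[OF p(2) s(1) p(2)] s(2) hom_Idn_left[OF p(2)] by simp
  then have "Comp A s p = Idn A x"
    using cofibrant_lift[OF assms(1) p p(2)] hom_comp[OF p(2) s(1)] hom_Idn[OF O(1)]
      hom_Idn_right[OF p(2)] by blast
  then show ?thesis using s inverse_arrows_hom[OF p(2)] by (auto simp: is_iso_def)
qed

text \<open>Dually, fibrancy of \<open>x\<close> gives a retraction of \<open>i\<close>, and
  uniqueness of extensions to the fibrant object \<open>y\<close> makes it a two-sided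
  inverse.\<close>

lemma TCoFib_fibrant_iso:
  assumes "fib x" "fib y" and i: "i \<in> CoFib \<inter> Weq" "i \<in> hom A x y"
  shows "is_iso A i"
proof -
  have O: "x \<in> Ob A" "y \<in> Ob A" using hom_Ob[OF i(2)] by auto
  obtain s where s: "s \<in> hom A y x" "Comp A s i = Idn A x"
    using fibrant_extend[OF assms(1) i hom_Idn[OF O(1)]] by blast
  have "Comp A (Comp A i s) i = i"
    using hom_assoc[OF i(2) s(1) i(2)] s(2) hom_Idn_right[OF i(2)] by simp
  then have "Comp A i s = Idn A y"
    using fibrant_extend[OF assms(2) i i(2)] hom_comp[OF s(1) i(2)] hom_Idn[OF O(2)]
      hom_Idn_left[OF i(2)] by blast
  then show ?thesis using s inverse_arrows_hom[OF i(2)] by (auto simp: is_iso_def)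
qed

text \<open>Factor \<open>f\<close> as a fibration \<open>p\<close> after a trivial cofibration
  \<open>i\<close>. Two-out-of-three makes \<open>p\<close> trivial, and closure under composition
  makes the middle object both cofibrant and fibrant, so each factor is an isomorphism by one of the
  two preceding lemmas.\<close>

lemma Weq_CF_iso:
  assumes x: "x \<in> CF" and y: "y \<in> CF" and f: "f \<in> Weq" "f \<in> hom A x y"
  shows "is_iso A f"
proof -
  obtain i p where i: "i \<in> CoFib \<inter> Weq" and p: "p \<in> Fib" and ip: "Cod A i = Dom A p"
    "f = Comp A p i"
    using CM4_TCoFib_Fib[of f] f by (auto simp: hom_def)
  define w where "w = Cod A i"
  have Ar: "i \<in> Ar A" "p \<in> Ar A" using i p CoFib_sub Fib_sub by auto
  then have ih: "i \<in> hom A x w" and ph: "p \<in> hom A w y"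
    using ip f by (auto simp: hom_def w_def)
  have "p \<in> Weq" using Weq_comp(2)[OF ih ph] i f ip by simp
  moreover have "cof w" using cofibrant_comp[OF _ _ ih] x i by blast
  ultimately have "is_iso A p" using TFib_cofibrant_iso[OF _ _ _ ph] y p by blast
  moreover have "fib w" using fibrant_comp[OF _ p ph] y by blast
  then have "is_iso A i" using TCoFib_fibrant_iso[OF _ _ i ih] x by blast
  ultimately show ?thesis using is_iso_comp[OF ih ph] ip by simp
qed

section \<open>The replacement functor \<open>R\<close>\<close>

text \<open>The arrow is chosen rather than its source, so \<open>Q x\<close> and its map to
  \<open>x\<close> come from a single choice; \<open>fib_repl\<close> follows the same
  pattern.\<close>

definition cof_repl :: "'a \<Rightarrow> 'b" where
  "cof_repl x = (SOME q. q \<in> Fib \<inter> Weq \<and> Cod A q = x \<and> cof (Dom A q))"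

abbreviation "Q x \<equiv> Dom A (cof_repl x)"

definition fib_repl :: "'a \<Rightarrow> 'b" where
  "fib_repl c = (SOME i. i \<in> CoFib \<inter> Weq \<and> Dom A i = c \<and> fib (Cod A i))"

abbreviation "R x \<equiv> Cod A (fib_repl (Q x))"

text \<open>The choice is possible by factoring the arrow from \<open>z\<close> to \<open>x\<close>
  as a cofibration followed by a trivial fibration.\<close>

lemma cof_repl:
  assumes "x \<in> Ob A"
  shows "cof_repl x \<in> Fib \<inter> Weq" "cof_repl x \<in> hom A (Q x) x" "cof (Q x)"
proof -
  obtain f where f: "f \<in> hom A z x" using zero assms unfolding zero_object_def by blast
  obtain j q where j: "j \<in> CoFib" and q: "q \<in> Fib \<inter> Weq" and jq: "Cod A j = Dom A q" "f = Comp A q j"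
    using CM4_CoFib_TFib[of f] f by (auto simp: hom_def)
  have "j \<in> Ar A" "q \<in> Ar A" using j q CoFib_sub Fib_sub by auto
  then have "j \<in> hom A z (Dom A q)" "Cod A q = x" using jq f by (auto simp: hom_def)
  then have "q \<in> Fib \<inter> Weq \<and> Cod A q = x \<and> cof (Dom A q)"
    using q j cofibrant_iff by blast
  from someI[of "\<lambda>q. q \<in> Fib \<inter> Weq \<and> Cod A q = x \<and> cof (Dom A q)", OF this]
  show "cof_repl x \<in> Fib \<inter> Weq" "cof_repl x \<in> hom A (Q x) x" "cof (Q x)"
    using Fib_sub by (auto simp: cof_repl_def hom_def)
qed

text \<open>Here the arrow from \<open>Q x\<close> to \<open>z\<close> is factored.
  \<open>R x\<close> remains cofibrant because it receives a cofibration from the cofibrant object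
  \<open>Q x\<close>.\<close>

lemma fib_repl:
  assumes "x \<in> Ob A"
  shows "fib_repl (Q x) \<in> CoFib \<inter> Weq" "fib_repl (Q x) \<in> hom A (Q x) (R x)" "R x \<in> CF"
proof -
  obtain f where f: "f \<in> hom A (Q x) z"
    using zero hom_Ob(1)[OF cof_repl(2)[OF assms]] unfolding zero_object_def by blast
  obtain i p where i: "i \<in> CoFib \<inter> Weq" and p: "p \<in> Fib" and ip: "Cod A i = Dom A p" "f = Comp A p i"
    using CM4_TCoFib_Fib[of f] f by (auto simp: hom_def)
  have "i \<in> Ar A" "p \<in> Ar A" using i p CoFib_sub Fib_sub by auto
  then have "p \<in> hom A (Cod A i) z" "Dom A i = Q x" using ip f by (auto simp: hom_def)
  then have "i \<in> CoFib \<inter> Weq \<and> Dom A i = Q x \<and> fib (Cod A i)"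
    using i p fibrant_iff by blast
  from someI[of "\<lambda>i. i \<in> CoFib \<inter> Weq \<and> Dom A i = Q x \<and> fib (Cod A i)", OF this]
  show 1: "fib_repl (Q x) \<in> CoFib \<inter> Weq" "fib_repl (Q x) \<in> hom A (Q x) (R x)"
    and "R x \<in> CF"
    using CoFib_sub cofibrant_comp[OF cof_repl(3)[OF assms]] by (auto simp: fib_repl_def hom_def)
qed

text \<open>\<open>replaces f h g\<close> says that \<open>h\<close> and \<open>g\<close> are \<open>Qf\<close> and \<open>Rf\<close>.\<close>

definition replaces :: "'b \<Rightarrow> 'b \<Rightarrow> 'b \<Rightarrow> bool" where
  "replaces f h g \<longleftrightarrow> h \<in> hom A (Q (Dom A f)) (Q (Cod A f)) \<and> g \<in> hom A (R (Dom A f)) (R (Cod A f)) \<and>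
    Comp A (cof_repl (Cod A f)) h = Comp A f (cof_repl (Dom A f)) \<and>
    Comp A g (fib_repl (Q (Dom A f))) = Comp A (fib_repl (Q (Cod A f))) h"

definition R_ar :: "'b \<Rightarrow> 'b" where
  "R_ar f = (THE g. \<exists>h. replaces f h g)"

text \<open>The coreflection property determines \<open>h\<close> from \<open>f\<close>, and then
  the reflection property determines \<open>g\<close> from \<open>h\<close>.\<close>

lemma replaces_ex1:
  assumes f: "f \<in> hom A x y" shows "\<exists>!g. \<exists>h. replaces f h g"
proof -
  have O: "x \<in> Ob A" "y \<in> Ob A" using hom_Ob[OF f] by auto
  note q = cof_repl[OF O(1)] and q' = cof_repl[OF O(2)] and i = fib_repl[OF O(1)] and i' = fib_repl[OF O(2)]
  have xy: "Dom A f = x" "Cod A f = y" using f by (auto simp: hom_def)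
  have H: "\<exists>!h. h \<in> hom A (Q x) (Q y) \<and> Comp A (cof_repl y) h = Comp A f (cof_repl x)"
    by (rule cofibrant_lift[OF q(3) q'(1,2) hom_comp[OF q(2) f]])
  have G: "\<exists>!g. g \<in> hom A (R x) (R y) \<and> Comp A g (fib_repl (Q x)) = Comp A (fib_repl (Q y)) h"
    if "h \<in> hom A (Q x) (Q y)" for h
    using fibrant_extend[OF _ i(1,2) hom_comp[OF that i'(2)]] i'(3) by blast
  obtain h where h: "h \<in> hom A (Q x) (Q y)" "Comp A (cof_repl y) h = Comp A f (cof_repl x)"
    using H by blast
  \<comment> \<open>Uniqueness of \<open>h\<close> collapses the existential quantifier over the
    first component, leaving a plain extension problem for \<open>g\<close>.\<close>
  then have "replaces f h' g \<longleftrightarrow> h' = h \<and> g \<in> hom A (R x) (R y) \<and>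
    Comp A g (fib_repl (Q x)) = Comp A (fib_repl (Q y)) h" for h' g
    unfolding replaces_def xy using H by blast
  then show ?thesis using G[OF h(1)] by simp
qed

text \<open>Reduces each functor law to exhibiting a pair of arrows that fits into the two squares
  of \<open>replaces\<close>.\<close>

lemma R_ar_eq:
  assumes "f \<in> hom A x y" "replaces f h g" shows "R_ar f = g"
  unfolding R_ar_def using replaces_ex1[OF assms(1)] assms(2) by (blast intro: the1_equality)

lemma replaces_R_ar:
  assumes "f \<in> hom A x y" obtains h where "replaces f h (R_ar f)"
  using theI'[OF replaces_ex1[OF assms]] unfolding R_ar_def by blast

lemma R_ar_hom: "f \<in> hom A x y \<Longrightarrow> R_ar f \<in> hom A (R x) (R y)"
  using replaces_R_ar[of f x y] by (auto simp: replaces_def hom_def)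

lemma R_ar_Idn:
  assumes x: "x \<in> Ob A" shows "R_ar (Idn A x) = Idn A (R x)"
proof (rule R_ar_eq[OF hom_Idn[OF x]])
  show "replaces (Idn A x) (Idn A (Q x)) (Idn A (R x))"
    using cof_repl(2)[OF x] fib_repl(2)[OF x] x hom_Idn hom_Ob hom_Idn_left hom_Idn_right
    unfolding replaces_def by (metis Cod_Idn Dom_Idn)
qed

text \<open>The squares for \<open>f\<close> and \<open>g\<close> paste to squares for the
  composite, and uniqueness identifies the result.\<close>

lemma R_ar_comp:
  assumes f: "f \<in> hom A x y" and g: "g \<in> hom A y w"
  shows "R_ar (Comp A g f) = Comp A (R_ar g) (R_ar f)"
proof -
  have O: "x \<in> Ob A" "y \<in> Ob A" "w \<in> Ob A" using hom_Ob[OF f] hom_Ob[OF g] by auto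
  have d: "Dom A f = x" "Cod A f = y" "Dom A g = y" "Cod A g = w"
    "Dom A (Comp A g f) = x" "Cod A (Comp A g f) = w"
    using f g hom_comp[OF f g] by (auto simp: hom_def)
  note q = cof_repl(2)[OF O(1)] cof_repl(2)[OF O(2)] cof_repl(2)[OF O(3)]
    and i = fib_repl(2)[OF O(1)] fib_repl(2)[OF O(2)] fib_repl(2)[OF O(3)]
  obtain h where h: "h \<in> hom A (Q x) (Q y)" "R_ar f \<in> hom A (R x) (R y)"
    "Comp A (cof_repl y) h = Comp A f (cof_repl x)"
    "Comp A (R_ar f) (fib_repl (Q x)) = Comp A (fib_repl (Q y)) h"
    using replaces_R_ar[OF f] unfolding replaces_def d by blast
  obtain k where k: "k \<in> hom A (Q y) (Q w)" "R_ar g \<in> hom A (R y) (R w)"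
    "Comp A (cof_repl w) k = Comp A g (cof_repl y)"
    "Comp A (R_ar g) (fib_repl (Q y)) = Comp A (fib_repl (Q w)) k"
    using replaces_R_ar[OF g] unfolding replaces_def d by blast
  have "replaces (Comp A g f) (Comp A k h) (Comp A (R_ar g) (R_ar f))"
    unfolding replaces_def d
  proof (intro conjI)
    show "Comp A (cof_repl w) (Comp A k h) = Comp A (Comp A g f) (cof_repl x)"
      using hom_assoc[OF h(1) k(1) q(3)] hom_assoc[OF h(1) q(2) g] hom_assoc[OF q(1) f g] h k by simp
    show "Comp A (Comp A (R_ar g) (R_ar f)) (fib_repl (Q x)) = Comp A (fib_repl (Q w)) (Comp A k h)"
      using hom_assoc[OF i(1) h(2) k(2)] hom_assoc[OF h(1) i(2) k(2)] hom_assoc[OF h(1) k(1) i(3)] h k by simp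
  qed (use hom_comp h k in blast)+
  then show ?thesis by (rule R_ar_eq[OF hom_comp[OF f g]])
qed

text \<open>Two-out-of-three is applied around both squares of \<open>replaces\<close>, whose
  replacement arrows are weak equivalences: first to pass from \<open>f\<close> to \<open>h\<close>,
  then from \<open>h\<close> to \<open>R_ar f\<close>.\<close>

lemma R_ar_Weq:
  assumes f: "f \<in> hom A x y" "f \<in> Weq" shows "R_ar f \<in> Weq"
proof -
  have O: "x \<in> Ob A" "y \<in> Ob A" using hom_Ob[OF f(1)] by auto
  have d: "Dom A f = x" "Cod A f = y" using f by (auto simp: hom_def)
  note q = cof_repl[OF O(1)] and q' = cof_repl[OF O(2)] and i = fib_repl[OF O(1)] and i' = fib_repl[OF O(2)]
  obtain h where h: "h \<in> hom A (Q x) (Q y)" "R_ar f \<in> hom A (R x) (R y)"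
    "Comp A (cof_repl y) h = Comp A f (cof_repl x)"
    "Comp A (R_ar f) (fib_repl (Q x)) = Comp A (fib_repl (Q y)) h"
    using replaces_R_ar[OF f(1)] unfolding replaces_def d by blast
  have "Comp A (cof_repl y) h \<in> Weq" unfolding h(3) using Weq_comp(1)[OF q(2) f(1)] q(1) f(2) by blast
  then have "h \<in> Weq" using Weq_comp(3)[OF h(1) q'(2)] q'(1) by blast
  then have "Comp A (R_ar f) (fib_repl (Q x)) \<in> Weq"
    unfolding h(4) using Weq_comp(1)[OF h(1) i'(2)] i'(1) by blast
  then show ?thesis using Weq_comp(2)[OF i(2) h(2)] i(1) by blast
qed

definition R_ftor :: "('a, 'b, 'a, 'b) ftor" where
  "R_ftor = \<lparr>FOb = (\<lambda>x. R x), FAr = R_ar\<rparr>"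

lemma is_ftor_R: "is_ftor A (full_subcategory A CF) R_ftor"
  unfolding is_ftor_def
proof (intro conjI ballI impI)
  show "category A" by unfold_locales
  show "category (full_subcategory A CF)" by (rule category_full_subcategory)
  show "FOb R_ftor x \<in> Ob (full_subcategory A CF)" if "x \<in> Ob A" for x
    using fib_repl(3)[OF that] CF_Ob by (simp add: R_ftor_def)
  show "FAr R_ftor f \<in> hom (full_subcategory A CF) (FOb R_ftor (Dom A f)) (FOb R_ftor (Cod A f))"
    if "f \<in> Ar A" for f
    using R_ar_hom[OF hom_self[OF that]] fib_repl(3) that
    by (simp add: R_ftor_def hom_full_subcategory)
  show "FAr R_ftor (Idn A x) = Idn (full_subcategory A CF) (FOb R_ftor x)" if "x \<in> Ob A" for x
    using R_ar_Idn[OF that] by (simp add: R_ftor_def)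
  show "FAr R_ftor (Comp A g f) = Comp (full_subcategory A CF) (FAr R_ftor g) (FAr R_ftor f)"
    if "f \<in> Ar A" "g \<in> Ar A" "Cod A f = Dom A g" for f g
    using R_ar_comp[OF hom_self[OF that(1)]] hom_self[OF that(2)] that(3) by (simp add: R_ftor_def)
qed

text \<open>This is the hypothesis under which \<open>R_ftor\<close> factors through the
  localization: \<open>R_ar w\<close> is a weak equivalence between cofibrant-fibrant
  objects.\<close>

lemma R_inverts_Weq:
  assumes "w \<in> Ar A" "w \<in> Weq" shows "is_iso (full_subcategory A CF) (FAr R_ftor w)"
proof -
  note w = hom_self[OF assms(1)]
  have CF: "R (Dom A w) \<in> CF" "R (Cod A w) \<in> CF" using fib_repl(3) assms(1) by blast+
  then have "is_iso A (R_ar w)"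
    using Weq_CF_iso[OF _ _ R_ar_Weq[OF w assms(2)] R_ar_hom[OF w]] by blast
  then show ?thesis
    using is_iso_full_subcategory[of A "R_ar w" CF] CF R_ar_hom[OF w]
    by (simp add: R_ftor_def hom_def)
qed

section \<open>Comparison of \<open>R\<close> with the identity, in \<open>A\<close> and in the
  localization\<close>

text \<open>As \<open>x\<close> is fibrant, \<open>cof_repl x\<close> extends along
  \<open>fib_repl (Q x)\<close> to an arrow from \<open>R x\<close> to \<open>x\<close>. It is a
  weak equivalence by two-out-of-three, hence an isomorphism; naturality follows from uniqueness of
  extensions along \<open>fib_repl (Q x)\<close>.\<close>

lemma R_ftor_iso_id:
  "\<exists>\<epsilon>. (\<forall>x \<in> CF. \<epsilon> x \<in> hom A (R x) x \<and> is_iso A (\<epsilon> x)) \<and>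
    (\<forall>x \<in> CF. \<forall>y \<in> CF. \<forall>f \<in> hom A x y. Comp A (\<epsilon> y) (R_ar f) = Comp A f (\<epsilon> x))"
proof -
  have "\<exists>e. e \<in> hom A (R x) x \<and> Comp A e (fib_repl (Q x)) = cof_repl x" if "x \<in> CF" for x
    using fibrant_extend[OF _ fib_repl(1,2) cof_repl(2), of x] that CF_Ob[OF that] by blast
  then obtain e where e: "\<And>x. x \<in> CF \<Longrightarrow> e x \<in> hom A (R x) x"
    "\<And>x. x \<in> CF \<Longrightarrow> Comp A (e x) (fib_repl (Q x)) = cof_repl x" by metis
  have "is_iso A (e x)" if x: "x \<in> CF" for x
  proof -
    note O = CF_Ob[OF x]
    have "e x \<in> Weq"
      using Weq_comp(2)[OF fib_repl(2)[OF O] e(1)[OF x]] fib_repl(1)[OF O] cof_repl(1)[OF O] e(2)[OF x]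
      by simp
    then show ?thesis using Weq_CF_iso[OF fib_repl(3)[OF O] x _ e(1)[OF x]] by blast
  qed
  moreover have "Comp A (e y) (R_ar f) = Comp A f (e x)"
    if x: "x \<in> CF" and y: "y \<in> CF" and f: "f \<in> hom A x y" for x y f
  proof -
    note O = CF_Ob[OF x] CF_Ob[OF y]
    have d: "Dom A f = x" "Cod A f = y" using f by (auto simp: hom_def)
    note i = fib_repl(1,2)[OF O(1)] and i' = fib_repl(2)[OF O(2)] and q = cof_repl(2)[OF O(1)]
      and ex = e(1)[OF x] and ey = e(1)[OF y]
    obtain h where h: "h \<in> hom A (Q x) (Q y)" "R_ar f \<in> hom A (R x) (R y)"
      "Comp A (cof_repl y) h = Comp A f (cof_repl x)"
      "Comp A (R_ar f) (fib_repl (Q x)) = Comp A (fib_repl (Q y)) h"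
      using replaces_R_ar[OF f] unfolding replaces_def d by blast
    have "Comp A (Comp A (e y) (R_ar f)) (fib_repl (Q x)) = Comp A f (cof_repl x)"
      using hom_assoc[OF i(2) h(2) ey] hom_assoc[OF h(1) i' ey] h e(2)[OF y] by simp
    moreover have "Comp A (Comp A f (e x)) (fib_repl (Q x)) = Comp A f (cof_repl x)"
      using hom_assoc[OF i(2) ex f] e(2)[OF x] by simp
    moreover have "fib y" using y by simp
    ultimately show ?thesis
      using fibrant_extend[OF _ i hom_comp[OF q f]] hom_comp[OF h(2) ey] hom_comp[OF ex f] by blast
  qed
  ultimately show ?thesis using e(1) by (intro exI[of _ e]) blast
qed

lemma localized_R_iso_id:
  defines "L \<equiv> localization A Weq" and "l \<equiv> FAr (localization_ftor A Weq)"
  shows "\<exists>\<eta>. (\<forall>x \<in> Ob A. \<eta> x \<in> hom L (R x) x \<and> is_iso L (\<eta> x)) \<and>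
    (\<forall>f \<in> Ar A. Comp L (\<eta> (Cod A f)) (l (R_ar f)) = Comp L (l f) (\<eta> (Dom A f)))"
proof -
  have A: "category A" by unfold_locales
  interpret L: category L unfolding L_def by (rule category_localization[OF A])
  have lh: "l f \<in> hom L x y" if "f \<in> hom A x y" for f x y
    using is_ftor_localization_ftor[OF A, of Weq] that
    by (auto simp: is_ftor_def L_def l_def hom_def localization_ftor_def)
  have lc: "l (Comp A g f) = Comp L (l g) (l f)" if "f \<in> hom A x y" "g \<in> hom A y w" for f g x y w
    using is_ftor_localization_ftor[OF A, of Weq] that
    by (auto simp: is_ftor_def L_def l_def hom_def)
  have li: "is_iso L (l w)" if "w \<in> Weq" for w
    using localization_inverts[OF A _ that] that Weq_sub unfolding is_iso_def L_def l_def by blast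
  \<comment> \<open>The witness is the image of \<open>cof_repl x\<close> after the inverse
    \<open>v\<close> of the image of \<open>fib_repl (Q x)\<close>. Only the equation stated here is
    kept, because naturality can be tested after composing with the isomorphism
    \<open>l (fib_repl (Q x))\<close>.\<close>
  have "\<exists>e. e \<in> hom L (R x) x \<and> is_iso L e \<and> Comp L e (l (fib_repl (Q x))) = l (cof_repl x)"
    if x: "x \<in> Ob A" for x
  proof -
    note i = lh[OF fib_repl(2)[OF x]] and q = lh[OF cof_repl(2)[OF x]]
    have "is_iso L (l (fib_repl (Q x)))" "is_iso L (l (cof_repl x))"
      using li fib_repl(1)[OF x] cof_repl(1)[OF x] by auto
    then obtain v where v: "v \<in> hom L (R x) (Q x)" "Comp L v (l (fib_repl (Q x))) = Idn L (Q x)"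
      "Comp L (l (fib_repl (Q x))) v = Idn L (R x)"
      using L.inverse_arrows_hom[OF i] by (auto simp: is_iso_def)
    have "is_iso L v" unfolding is_iso_def L.inverse_arrows_hom[OF v(1)] using v i by blast
    moreover have "Comp L (Comp L (l (cof_repl x)) v) (l (fib_repl (Q x))) = l (cof_repl x)"
      using L.hom_assoc[OF i v(1) q] v(2) L.hom_Idn_right[OF q] by simp
    ultimately show ?thesis
      using L.hom_comp[OF v(1) q] L.is_iso_comp[OF v(1) q] \<open>is_iso L (l (cof_repl x))\<close> by blast
  qed
  then obtain e where e: "\<And>x. x \<in> Ob A \<Longrightarrow> e x \<in> hom L (R x) x"
    "\<And>x. x \<in> Ob A \<Longrightarrow> is_iso L (e x)"
    "\<And>x. x \<in> Ob A \<Longrightarrow> Comp L (e x) (l (fib_repl (Q x))) = l (cof_repl x)" by metis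
  have "Comp L (e y) (l (R_ar f)) = Comp L (l f) (e x)" if f: "f \<in> hom A x y" for f x y
  proof -
    have O: "x \<in> Ob A" "y \<in> Ob A" using hom_Ob[OF f] by auto
    have d: "Dom A f = x" "Cod A f = y" using f by (auto simp: hom_def)
    note i = fib_repl(2)[OF O(1)] and i' = fib_repl(2)[OF O(2)]
      and q = cof_repl(2)[OF O(1)] and q' = cof_repl(2)[OF O(2)]
      and ex = e(1)[OF O(1)] and ey = e(1)[OF O(2)]
    obtain h where h: "h \<in> hom A (Q x) (Q y)" "R_ar f \<in> hom A (R x) (R y)"
      "Comp A (cof_repl y) h = Comp A f (cof_repl x)"
      "Comp A (R_ar f) (fib_repl (Q x)) = Comp A (fib_repl (Q y)) h"
      using replaces_R_ar[OF f] unfolding replaces_def d by blast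
    have "Comp L (Comp L (e y) (l (R_ar f))) (l (fib_repl (Q x)))
      = Comp L (e y) (Comp L (l (fib_repl (Q y))) (l h))"
      using L.hom_assoc[OF lh[OF i] lh[OF h(2)] ey] lc[OF i h(2)] lc[OF h(1) i'] h(4) by simp
    also have "\<dots> = l (Comp A f (cof_repl x))"
      using L.hom_assoc[OF lh[OF h(1)] lh[OF i'] ey] e(3)[OF O(2)] lc[OF h(1) q'] h(3) by simp
    also have "\<dots> = Comp L (Comp L (l f) (e x)) (l (fib_repl (Q x)))"
      using L.hom_assoc[OF lh[OF i] ex lh[OF f]] e(3)[OF O(1)] lc[OF q f] by simp
    finally show ?thesis
      using L.iso_cancel_right[OF lh[OF i] _ L.hom_comp[OF lh[OF h(2)] ey] L.hom_comp[OF ex lh[OF f]]]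
        li fib_repl(1)[OF O(1)] by blast
  qed
  then show ?thesis using e(1,2) hom_self by (intro exI[of _ e]) blast
qed

section \<open>The equivalence of categories\<close>

theorem localization_equivalent_CF:
  "equivalent_categories (localization A Weq) (full_subcategory A CF)"
proof -
  have A: "category A" by unfold_locales
  let ?L = "localization A Weq" and ?S = "full_subcategory A CF" and ?l = "localization_ftor A Weq"
  \<comment> \<open>\<open>G\<close> is the factorization of \<open>R_ftor\<close> given by the
    universal property; its values on images of arrows of \<open>A\<close> suffice below.\<close>
  obtain G where G: "is_ftor ?L ?S G" "\<And>x. x \<in> Ob A \<Longrightarrow> FOb G x = R x"
    "\<And>f. f \<in> Ar A \<Longrightarrow> FAr G (FAr ?l f) = R_ar f"
    using localization_universal_existence[OF is_ftor_R R_inverts_Weq, of Weq]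
    by (auto simp: R_ftor_def)
  \<comment> \<open>The quasi-inverse is the inclusion of the subcategory followed by the
    localization functor.\<close>
  define J where "J = comp_ftor ?l (id_ftor :: ('a, 'b, 'a, 'b) ftor)"
  have J: "is_ftor ?S ?L J"
    unfolding J_def
    by (rule is_ftor_comp[OF is_ftor_inclusion[OF A] is_ftor_localization_ftor[OF A]])
  have Jsel: "FOb J x = x" "FAr J f = FAr ?l f" for x f
    by (simp_all add: J_def comp_ftor_def id_ftor_def localization_ftor_def)
  note JG = is_ftor_comp[OF G(1) J] and GJ = is_ftor_comp[OF J G(1)]
  note idL = is_ftor_id[OF category_localization[OF A, of Weq]]
  note idS = is_ftor_id[OF category_full_subcategory[of CF]]
  have "naturally_isomorphic ?L ?L (comp_ftor J G) id_ftor"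
  proof -
    obtain \<eta> where \<eta>: "\<And>x. x \<in> Ob A \<Longrightarrow> \<eta> x \<in> hom ?L (R x) x \<and> is_iso ?L (\<eta> x)"
      "\<And>f. f \<in> Ar A \<Longrightarrow> Comp ?L (\<eta> (Cod A f)) (FAr ?l (R_ar f)) = Comp ?L (FAr ?l f) (\<eta> (Dom A f))"
      using localized_R_iso_id by blast
    have \<eta>_hom: "\<eta> x \<in> hom ?L (FOb (comp_ftor J G) x) x" if "x \<in> Ob A" for x
      using \<eta>(1)[OF that] G(2)[OF that] by (simp add: comp_ftor_def Jsel)
    \<comment> \<open>The family \<eta> is natural for arrows of \<open>A\<close>;
      \<open>localization_natural\<close> extends this to all arrows of the localization.\<close>
    moreover have "Comp ?L (\<eta> (Cod ?L a)) (FAr (comp_ftor J G) a)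
      = Comp ?L a (\<eta> (Dom ?L a))" if "a \<in> Ar ?L" for a
      using localization_natural[OF A JG idL, of \<eta> a] \<eta>_hom \<eta>(2) G(3) that
      by (simp add: comp_ftor_def id_ftor_def Jsel del: localization_sel(2-5))
    ultimately show ?thesis
      unfolding naturally_isomorphic_def using JG idL \<eta>(1) \<eta>_hom
      by (intro conjI exI[of _ \<eta>]) (simp_all add: id_ftor_def del: localization_sel(2-5))
  qed
  moreover have "naturally_isomorphic ?S ?S (comp_ftor G J) id_ftor"
  proof -
    obtain \<epsilon> where \<epsilon>: "\<And>x. x \<in> CF \<Longrightarrow> \<epsilon> x \<in> hom A (R x) x \<and> is_iso A (\<epsilon> x)"
      "\<And>x y f. x \<in> CF \<Longrightarrow> y \<in> CF \<Longrightarrow> f \<in> hom A x y \<Longrightarrow> Comp A (\<epsilon> y) (R_ar f) = Comp A f (\<epsilon> x)"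
      using R_ftor_iso_id by blast
    have "\<epsilon> x \<in> hom ?S (FOb (comp_ftor G J) x) x \<and> is_iso ?S (\<epsilon> x)"
      if "x \<in> Ob ?S" for x
    proof -
      have x: "x \<in> CF" "x \<in> Ob A" using that by auto
      have "is_iso ?S (\<epsilon> x)"
        using is_iso_full_subcategory[of A "\<epsilon> x" CF] \<epsilon>(1)[OF x(1)] fib_repl(3)[OF x(2)] x(1)
        by (simp add: hom_def)
      then show ?thesis
        using \<epsilon>(1)[OF x(1)] fib_repl(3)[OF x(2)] x G(2)[OF x(2)]
        by (simp add: comp_ftor_def Jsel hom_full_subcategory)
    qed
    moreover have "Comp ?S (\<epsilon> (Cod ?S f)) (FAr (comp_ftor G J) f)
      = Comp ?S f (\<epsilon> (Dom ?S f))" if "f \<in> Ar ?S" for f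
      using \<epsilon>(2)[OF _ _ hom_self] that G(3) by (simp add: comp_ftor_def Jsel)
    ultimately show ?thesis
      unfolding naturally_isomorphic_def using GJ idS by (auto simp: id_ftor_def)
  qed
  ultimately show ?thesis
    unfolding equivalent_categories_def using G(1) J by blast
qed

end

theorem mainTheorem2:
  fixes A :: "('o, 'm) cat" and zero :: 'o and CoFib Fib Weq :: "'m set"
  assumes "category A"
    and "zero_object A zero"
    and "orthogonal_model_structure A CoFib Fib Weq"
  shows "equivalent_categories (homotopy_category A Weq)
    (full_subcategory A {X. cofibrant A zero CoFib X \<and> fibrant A zero Fib X})"
proof -
  interpret pointed_orthogonal_model_structure A CoFib Fib Weq zero
    using assms by (simp add: pointed_orthogonal_model_structure_def
        pointed_orthogonal_model_structure_axioms_def)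
  show ?thesis
    unfolding homotopy_category_def by (rule localization_equivalent_CF)
qed

end
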